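(* Let $S\subseteq\Sigma^n$ be a double-MDS-code. Then: (a) There exist an integer $k\in[n]$, a partition $\{K_1,\ldots,K_k\}$ of $[n]$ into nonempty sets with $n_j=|K_j|$, prime double-MDS-codes $S_j\subseteq\Sigma^{n_j}$ with $\bar 0=(0,\ldots,0)\in S_j$ ($j\in[k]$), and $\sigma_0\in\{0,1\}$ such that $$\chi_S(\bar x)=\bigoplus_{j=1}^k\chi_{S_j}(\bar x_{K_j})\oplus\sigma_0\qquad\text{for all }\bar x\in\Sigma^n,$$ and this representation is unique: the number $k$, the partition $\{K_1,\ldots,K_k\}$ together with the codes $S_j$ attached to its blocks, and the constant $\sigma_0$ are uniquely determined by $S$. (b) $S$ is the union of $2^{k-1}$ pairwise disjoint prime double-codes of equal cardinality, and $\Sigma^n\setminus S$ is likewise the union of $2^{k-1}$ pairwise disjoint prime double-codes of equal cardinality. Equivalently, each of $G(S)$ and $G(\Sigma^n\setminus S)$ has exactly $2^{k-1}$ connected components, all of the same size. (c) If $k\ge 2$ and $G(S)$ is bipartite, then for every $j\in[k]$ the graphs $G(S_j)$ and $G(\Sigma^{n_j}\setminus S_j)$ are bipartite.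
   Context: Let $\Sigma=\{0,1,2,3\}$ and $[n]=\{1,\ldots,n\}$. An $i$-line of $\Sigma^n$ is a set of the four words that agree in all coordinates except the $i$th; a line is an $i$-line for some $i\in[n]$. A set $S\subseteq\Sigma^n$ is a double-code if every line contains either $0$ or $2$ elements of $S$, and a double-MDS-code if every line contains exactly $2$ elements of $S$. A double-code is complementable if it is contained in some double-MDS-code, and prime if it is complementable, nonempty, and cannot be partitioned into two or more nonempty double-codes. The adjacency graph $G(S)$ of $S\subseteq\Sigma^n$ has vertex set $S$, two vertices being adjacent iff they differ in exactly one coordinate. $\chi_S:\Sigma^n\to\{0,1\}$ is the characteristic function of $S$ and $\oplus$ is addition modulo $2$. For $K=\{i_1<\cdots<i_m\}\subseteq[n]$ and $\bar x=(x_1,\ldots,x_n)$, write $\bar x_K=(x_{i_1},\ldots,x_{i_m})$. *)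

theory Defs
  imports Main
begin

text \<open>Words of length n over the alphabet {0,1,2,3}; coordinates are indexed 0..n-1
  (coordinate i here corresponds to coordinate i+1 of the paper).\<close>

definition words :: "nat \<Rightarrow> nat list set" where
  "words n = {x. length x = n \<and> set x \<subseteq> {0..<4}}"

definition line :: "nat list \<Rightarrow> nat \<Rightarrow> nat list set" where
  "line x i = {x[i := a] | a. a < 4}"

definition double_code :: "nat \<Rightarrow> nat list set \<Rightarrow> bool" where
  "double_code n S \<longleftrightarrow> S \<subseteq> words n \<and>
     (\<forall>x\<in>words n. \<forall>i<n. card (S \<inter> line x i) = 0 \<or> card (S \<inter> line x i) = 2)"

definition double_MDS :: "nat \<Rightarrow> nat list set \<Rightarrow> bool" where
  "double_MDS n S \<longleftrightarrow> S \<subseteq> words n \<and>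
     (\<forall>x\<in>words n. \<forall>i<n. card (S \<inter> line x i) = 2)"

definition complementable :: "nat \<Rightarrow> nat list set \<Rightarrow> bool" where
  "complementable n S \<longleftrightarrow> double_code n S \<and> (\<exists>T. double_MDS n T \<and> S \<subseteq> T)"

definition is_partition :: "'a set set \<Rightarrow> 'a set \<Rightarrow> bool" where
  "is_partition P S \<longleftrightarrow> \<Union>P = S \<and> {} \<notin> P \<and>
     (\<forall>A\<in>P. \<forall>B\<in>P. A \<noteq> B \<longrightarrow> A \<inter> B = {})"

definition prime_code :: "nat \<Rightarrow> nat list set \<Rightarrow> bool" where
  "prime_code n S \<longleftrightarrow> complementable n S \<and> S \<noteq> {} \<and>
     \<not> (\<exists>P. is_partition P S \<and> finite P \<and> card P \<ge> 2 \<and> (\<forall>A\<in>P. double_code n A))"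

definition adj :: "nat list \<Rightarrow> nat list \<Rightarrow> bool" where
  "adj x y \<longleftrightarrow> length x = length y \<and> card {i. i < length x \<and> x ! i \<noteq> y ! i} = 1"

definition reach :: "nat list set \<Rightarrow> nat list \<Rightarrow> nat list \<Rightarrow> bool" where
  "reach S = (\<lambda>a b. a \<in> S \<and> b \<in> S \<and> adj a b)\<^sup>*\<^sup>*"

definition components :: "nat list set \<Rightarrow> nat list set set" where
  "components S = {{y \<in> S. reach S x y} | x. x \<in> S}"

definition bipartite :: "nat list set \<Rightarrow> bool" where
  "bipartite S \<longleftrightarrow> (\<exists>c :: nat list \<Rightarrow> bool. \<forall>x\<in>S. \<forall>y\<in>S. adj x y \<longrightarrow> c x \<noteq> c y)"

definition repr :: "nat \<Rightarrow> nat list set \<Rightarrow> nat \<Rightarrow> (nat \<Rightarrow> nat set) \<Rightarrow> (nat \<Rightarrow> nat list set) \<Rightarrow> nat \<Rightarrow> bool" where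
  "repr n S k K C \<sigma>0 \<longleftrightarrow>
     1 \<le> k \<and> k \<le> n \<and>
     (\<forall>j<k. K j \<noteq> {}) \<and>
     (\<forall>j<k. \<forall>j'<k. j \<noteq> j' \<longrightarrow> K j \<inter> K j' = {}) \<and>
     (\<Union>j<k. K j) = {0..<n} \<and>
     (\<forall>j<k. double_MDS (card (K j)) (C j) \<and> prime_code (card (K j)) (C j) \<and>
             replicate (card (K j)) 0 \<in> C j) \<and>
     \<sigma>0 \<in> {0, 1} \<and>
     (\<forall>x\<in>words n. of_bool (x \<in> S) =
        ((\<Sum>j<k. of_bool (nths x (K j) \<in> C j)) + \<sigma>0) mod (2::nat))"

end

theory Submission
  imports Defs
begin

text \<open>
Call two coordinates linked if some two-dimensional plane in these directions is indecomposable,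
i.e. the characteristic function of \<open>S\<close> on it is not a sum of functions of one coordinate each. If no
coordinate of \<open>U\<close> is linked to one of \<open>V\<close>, the function separates into a part depending on \<open>U\<close> and
a part depending on \<open>V\<close>. So the blocks of the representation are the connected components of the
linkage relation, and conversely a prime factor cannot be split between unlinked coordinates, which
gives uniqueness.

The heart of the matter is that the factors, and their complements, have connected graphs. Colour
\<open>S\<close> so that adjacent words get the same colour; then every line has a colour. We show that for linked
\<open>i\<close>, \<open>j\<close> the \<open>i\<close>-line and the \<open>j\<close>-line through any word have the same colour. Otherwise take a
two-coloured \<open>(i, j)\<close>-plane as near as possible to an indecomposable one. A two-coloured plane consists
of two \<open>2 \<times> 2\<close> squares. Its neighbour one step nearer to the indecomposable plane is
one-coloured, which forces it to be the complement, and forces some third parallel plane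
on the same line to be an equal, two-coloured one. Since lines are balanced, replacing the remaining
coordinates one by one only complements the plane each time, so the indecomposable plane would be
decomposable.

Hence the components of \<open>S\<close> are the sets of words on which every factor has a prescribed value. Each
factor halves the words, so all components have the same size.
\<close>

section \<open>Balanced functions on the alphabet\<close>

datatype letter = L0 | L1 | L2 | L3

lemma UNIV_letter: "UNIV = {L0, L1, L2, L3}"
  using letter.exhaust by blast

lemma finite_letter: "finite (A :: letter set)"
  by (rule finite_subset[OF subset_UNIV]) (simp add: UNIV_letter)

lemma all_letter: "(\<forall>a. P a) \<longleftrightarrow> P L0 \<and> P L1 \<and> P L2 \<and> P L3"
  by (metis letter.exhaust)

lemma ex_letter: "(\<exists>a. P a) \<longleftrightarrow> P L0 \<or> P L1 \<or> P L2 \<or> P L3"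
  by (metis letter.exhaust)

definition bal :: "(letter \<Rightarrow> bool) \<Rightarrow> bool" where
  "bal f \<longleftrightarrow> card {a. f a} = 2"

lemma card_letter: "card {a. f a} = of_bool (f L0) + of_bool (f L1) + of_bool (f L2) + of_bool (f L3)"
proof -
  have "{a. f a} = {a \<in> {L0, L1, L2, L3}. f a}"
    using UNIV_letter by auto
  then show ?thesis
    by (cases "f L0"; cases "f L1"; cases "f L2"; cases "f L3") (simp_all add: Collect_conv_if conj_disj_distribR Collect_disj_eq cong: conj_cong)
qed

text \<open>Spelling balance out on the four letters turns statements about 4 x 4 planes into finite
  propositional checks.\<close>

lemma bal_iff: "bal f \<longleftrightarrow> (if f L0 then (if f L1 then \<not> f L2 \<and> \<not> f L3 else f L2 \<noteq> f L3)
    else (if f L1 then f L2 \<noteq> f L3 else f L2 \<and> f L3))"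
  unfolding bal_def card_letter by (simp split: if_splits)

text \<open>A row meets \<open>P\<close> only in columns with the same label. Counting cells gives
  as many True rows as True columns; a disagreement of labels puts this number strictly between 0
  and 4. As every row and column has two cells, it is 2, and \<open>P\<close> fills two 2 x 2
  squares.\<close>

lemma two_coloured_plane:
  assumes "\<And>a. bal (P a)" "\<And>b. bal (\<lambda>a. P a b)"
    and "\<And>a b. P a b \<Longrightarrow> \<rho> a = \<kappa> b" and "\<rho> a0 \<noteq> \<kappa> b0"
  shows "P a b \<longleftrightarrow> \<rho> a = \<kappa> b"
proof -
  have 1: "\<forall>a. bal (P a)" "\<forall>b. bal (\<lambda>a. P a b)" "\<forall>a b. P a b \<longrightarrow> \<rho> a = \<kappa> b" "\<exists>a b. \<rho> a \<noteq> \<kappa> b"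
    using assms by auto
  have "\<forall>a b. P a b \<longleftrightarrow> \<rho> a = \<kappa> b"
    using 1 unfolding all_letter ex_letter bal_iff by (smt (verit))
  then show ?thesis by blast
qed

text \<open>Balance of \<open>P\<close> makes \<open>\<rho>\<close> and \<open>\<kappa>\<close> take
  each value twice. In the two rows with label other than \<open>t\<close>, \<open>Q\<close> avoids
  \<open>P\<close> and so is its complement. This exhausts two columns of \<open>Q\<close>, and the
  other two rows must use the remaining columns, again off \<open>P\<close>.\<close>

lemma opposite_plane:
  fixes \<rho> \<kappa> :: "letter \<Rightarrow> bool"
  assumes "\<And>a. bal (P a)" "\<And>b. bal (\<lambda>a. P a b)"
    and "\<And>a. bal (Q a)" "\<And>b. bal (\<lambda>a. Q a b)"
    and "\<And>a b. P a b \<longleftrightarrow> \<rho> a = \<kappa> b" and "\<And>a b. P a b \<Longrightarrow> Q a b \<Longrightarrow> \<rho> a = t"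
  shows "Q a b \<longleftrightarrow> \<not> P a b"
proof -
  have 1: "\<forall>a. bal (P a)" "\<forall>b. bal (\<lambda>a. P a b)" "\<forall>a. bal (Q a)" "\<forall>b. bal (\<lambda>a. Q a b)"
   "\<forall>a b. P a b \<longleftrightarrow> \<rho> a = \<kappa> b" "\<forall>a b. P a b \<longrightarrow> Q a b \<longrightarrow> \<rho> a = t"
    using assms by auto
  have "\<forall>a b. Q a b \<longleftrightarrow> \<not> P a b"
    using 1 unfolding all_letter ex_letter bal_iff by (smt (verit))
  then show ?thesis by blast
qed

text \<open>The prescribed colour is \<open>t\<close> except on one of the two 2 x 2 squares of
  \<open>P\<close>. Rows and columns of \<open>Q\<close> are one-coloured, so \<open>Q\<close>
  contains that square or misses it; balance then settles the other three squares.\<close>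

lemma equal_or_opposite_plane:
  fixes \<rho> \<kappa> :: "letter \<Rightarrow> bool"
  assumes "\<And>a. bal (P a)" "\<And>b. bal (\<lambda>a. P a b)"
    and "\<And>a. bal (Q a)" "\<And>b. bal (\<lambda>a. Q a b)"
    and "\<And>a b. P a b \<longleftrightarrow> \<rho> a = \<kappa> b"
    and "\<And>a b. Q a b \<Longrightarrow> \<rho>' a = (if P a b then \<rho> a else t)"
    and "\<And>a b. Q a b \<Longrightarrow> \<kappa>' b = (if P a b then \<rho> a else t)"
  shows "(\<forall>a b. Q a b \<longleftrightarrow> P a b) \<or> (\<forall>a b. Q a b \<longleftrightarrow> \<not> P a b)"
proof -
  have 1: "\<forall>a. bal (P a)" "\<forall>b. bal (\<lambda>a. P a b)" "\<forall>a. bal (Q a)" "\<forall>b. bal (\<lambda>a. Q a b)"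
   "\<forall>a b. P a b \<longleftrightarrow> \<rho> a = \<kappa> b" "\<forall>a b. Q a b \<longrightarrow> \<rho>' a = (if P a b then \<rho> a else t)"
   "\<forall>a b. Q a b \<longrightarrow> \<kappa>' b = (if P a b then \<rho> a else t)"
    using assms by auto
  show ?thesis
    using 1 unfolding all_letter ex_letter bal_iff by (smt (verit))
qed

lemma bal_Not: "bal (\<lambda>a. \<not> f a) \<longleftrightarrow> bal f"
  unfolding bal_iff by auto

lemma bal_eq_const: "bal (\<lambda>a. f a = t) \<longleftrightarrow> bal f"
  by (cases t) (simp_all add: bal_Not)

lemma bal_flip:
  assumes "bal f" "f a = f b" "a \<noteq> b" "e \<noteq> a" "e \<noteq> b"
  shows "f e \<longleftrightarrow> \<not> f a"
proof (rule ccontr)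
  assume "\<not> (f e \<longleftrightarrow> \<not> f a)"
  then have "card {a. f a = f e} \<ge> 3"
    using assms card_mono[OF finite_letter, of "{a, b, e}" "{a. f a = f e}"] by simp
  then show False
    using assms(1) bal_eq_const[of f "f e"] by (simp add: bal_def)
qed

lemma bal_ex: "bal f \<Longrightarrow> \<exists>a. f a = t"
  unfolding bal_iff ex_letter by (auto split: if_splits)

section \<open>Linked coordinates and colourings\<close>

text \<open>Over the two-element field: some mixed difference of \<open>F\<close> in directions
  \<open>i\<close>, \<open>j\<close> is nonzero. For \<open>i = j\<close> this degenerates to
  dependence of \<open>F\<close> on coordinate \<open>i\<close>, which is harmless because only
  chains of linked coordinates matter.\<close>

definition indec :: "((nat \<Rightarrow> letter) \<Rightarrow> bool) \<Rightarrow> nat \<Rightarrow> nat \<Rightarrow> bool" where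
  "indec F i j \<longleftrightarrow> (\<exists>x a b. (F x = F (x(i := a))) \<noteq> (F (x(j := b)) = F (x(i := a, j := b))))"

lemma indec_sym: "indec F i j \<Longrightarrow> indec F j i"
  unfolding indec_def
proof (elim exE)
  fix x a b
  assume *: "(F x = F (x(i := a))) \<noteq> (F (x(j := b)) = F (x(i := a, j := b)))"
  show "\<exists>x a b. (F x = F (x(j := a))) \<noteq> (F (x(i := b)) = F (x(j := a, i := b)))"
  proof (cases "i = j")
    case True
    then show ?thesis using * by blast
  next
    case False
    then have "x(i := a, j := b) = x(j := b, i := a)" by (rule fun_upd_twist)
    then show ?thesis using * by (intro exI[of _ x] exI[of _ b] exI[of _ a]) (simp only:, argo)
  qed
qed

lemma indec_eq_const: "indec (\<lambda>x. F x = t) = indec F"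
  unfolding indec_def fun_eq_iff by (cases t) auto

text \<open>A double-MDS-code seen as a function on total assignments, so that changing a letter is
  a function update; by \<open>dep\<close> the letters off \<open>I\<close> have no
  influence.\<close>

locale balanced =
  fixes I :: "nat set" and F :: "(nat \<Rightarrow> letter) \<Rightarrow> bool"
  assumes finI: "finite I"
    and dep: "\<And>x y. (\<And>i. i \<in> I \<Longrightarrow> x i = y i) \<Longrightarrow> F x = F y"
    and bal: "\<And>x i. i \<in> I \<Longrightarrow> bal (\<lambda>a. F (x(i := a)))"
begin

lemma indec_in: "indec F i j \<Longrightarrow> i \<in> I \<and> j \<in> I"
proof -
  have "i \<in> I" if "indec F i j" for i j
  proof (rule ccontr)
    assume "i \<notin> I"
    then have "F (x(i := a)) = F x" "F (x(i := a, j := b)) = F (x(j := b))" for x a b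
      by (auto intro!: dep)
    then show False using that unfolding indec_def by blast
  qed
  then show "indec F i j \<Longrightarrow> i \<in> I \<and> j \<in> I" using indec_sym by blast
qed

end

text \<open>The colours used later express reachability from a fixed word, so a common colour of two
  points yields a path.\<close>

locale colouring = balanced +
  fixes c :: "(nat \<Rightarrow> letter) \<Rightarrow> bool"
  assumes col: "\<And>x i a b. i \<in> I \<Longrightarrow> F (x(i := a)) \<Longrightarrow> F (x(i := b)) \<Longrightarrow> c (x(i := a)) = c (x(i := b))"
begin

text \<open>For \<open>i\<close> in \<open>I\<close> the line contains code points by balance, and
  by \<open>col\<close> they share one colour, which this selects. The point \<open>x\<close> itself
  may lie outside the code.\<close>

definition line_colour :: "nat \<Rightarrow> (nat \<Rightarrow> letter) \<Rightarrow> bool" where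
  "line_colour i x \<longleftrightarrow> (\<exists>a. F (x(i := a)) \<and> c (x(i := a)))"

lemma line_colour_upd [simp]: "line_colour i (x(i := a)) = line_colour i x"
  by (simp add: line_colour_def)

lemma line_colour_eq: "i \<in> I \<Longrightarrow> F x \<Longrightarrow> line_colour i x = c x"
  unfolding line_colour_def using col[of i x _ "x i"] by (auto intro: exI[of _ "x i"])

section \<open>Planes in two directions, and their colours\<close>

context
  fixes i j :: nat
  assumes ij: "i \<in> I" "j \<in> I" "i \<noteq> j"
begin

definition plane :: "(nat \<Rightarrow> letter) \<Rightarrow> letter \<Rightarrow> letter \<Rightarrow> bool" where
  "plane z a b \<longleftrightarrow> F (z(i := a, j := b))"

text \<open>The plane through \<open>z\<close> contains points of both colours.\<close>

definition mixed :: "(nat \<Rightarrow> letter) \<Rightarrow> bool" where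
  "mixed z \<longleftrightarrow> (\<exists>a b. line_colour j (z(i := a)) \<noteq> line_colour i (z(j := b)))"

definition plane_colour :: "(nat \<Rightarrow> letter) \<Rightarrow> letter \<Rightarrow> letter \<Rightarrow> bool" where
  "plane_colour z a b = c (z(i := a, j := b))"

lemma plane_bal: "bal (plane z a)" "bal (\<lambda>a. plane z a b)"
proof -
  show "bal (plane z a)" unfolding plane_def using bal[OF ij(2)] .
  have "bal (\<lambda>a. F (z(j := b, i := a)))" using bal[OF ij(1)] .
  then show "bal (\<lambda>a. plane z a b)" unfolding plane_def by (simp only: fun_upd_twist[OF ij(3)])
qed

lemma plane_line_colour:
  assumes "plane z a b"
  shows "line_colour j (z(i := a)) = plane_colour z a b" "line_colour i (z(j := b)) = plane_colour z a b"
proof -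
  show "line_colour j (z(i := a)) = plane_colour z a b"
    using line_colour_eq[OF ij(2) assms[unfolded plane_def]] by (simp only: line_colour_upd plane_colour_def)
  have "line_colour i (z(i := a, j := b)) = line_colour i (z(j := b))"
    by (simp only: fun_upd_twist[OF ij(3)] line_colour_upd)
  then show "line_colour i (z(j := b)) = plane_colour z a b"
    using line_colour_eq[OF ij(1) assms[unfolded plane_def]] by (simp only: plane_colour_def)
qed

lemma plane_parallel:
  assumes l: "l \<in> I" "l \<noteq> i" "l \<noteq> j"
  shows "bal (\<lambda>e. plane (z(l := e)) a b)"
    and "plane (z(l := e)) a b \<Longrightarrow> plane (z(l := f)) a b \<Longrightarrow> plane_colour (z(l := e)) a b = plane_colour (z(l := f)) a b"
proof -
  have upd: "z(l := e, i := a, j := b) = z(i := a, j := b, l := e)" for e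
    using l by (auto simp: fun_eq_iff)
  show "bal (\<lambda>e. plane (z(l := e)) a b)"
    unfolding plane_def upd using bal[OF l(1)] .
  show "plane (z(l := e)) a b \<Longrightarrow> plane (z(l := f)) a b \<Longrightarrow> plane_colour (z(l := e)) a b = plane_colour (z(l := f)) a b"
    unfolding plane_def plane_colour_def upd using col[OF l(1)] .
qed

lemma mixed_plane: "mixed z \<Longrightarrow> plane z a b \<longleftrightarrow> line_colour j (z(i := a)) = line_colour i (z(j := b))"
  unfolding mixed_def
  by (elim exE, rule two_coloured_plane[where P = "plane z"]) (rule plane_bal, rule plane_bal, simp only: plane_line_colour)

text \<open>Once the plane at \<open>e\<close> is known to be the complement, every cell belongs to
  the plane at \<open>z\<close> or at \<open>e\<close>. So \<open>l\<close>-lines prescribe the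
  colour of each code point in any third parallel plane, which leaves only two shapes for that
  plane.\<close>

lemma mixed_step:
  assumes z: "mixed z" and l: "l \<in> I" "l \<noteq> i" "l \<noteq> j" and e: "\<not> mixed (z(l := e))"
  shows "\<exists>e'. e' \<noteq> e \<and> e' \<noteq> z l \<and> mixed (z(l := e')) \<and> (\<forall>a b. plane (z(l := e')) a b = plane z a b)"
proof -
  define \<rho> where "\<rho> a = line_colour j (z(i := a))" for a
  define \<kappa> where "\<kappa> b = line_colour i (z(j := b))" for b
  have pl: "plane z a b \<longleftrightarrow> \<rho> a = \<kappa> b" for a b
    unfolding \<rho>_def \<kappa>_def using mixed_plane[OF z] .
  \<comment> \<open>The plane at \<open>e\<close> is one-coloured, so any of its lines gives the
    common colour; row \<open>L0\<close> is an arbitrary choice.\<close>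
  define t where "t = line_colour j (z(l := e, i := L0))"
  have t: "plane_colour (z(l := e)) a b = t" if "plane (z(l := e)) a b" for a b
    using e plane_line_colour[OF that] unfolding mixed_def t_def by blast
  have par: "plane_colour (z(l := f)) a b = \<rho> a" if "plane z a b" "plane (z(l := f)) a b" for f a b
    using plane_parallel(2)[OF l, of z "z l" a b f] that plane_line_colour(1)[OF that(1)] by (simp add: \<rho>_def)
  have Pe: "plane (z(l := e)) a b \<longleftrightarrow> \<not> plane z a b" for a b
  proof (rule opposite_plane[where \<rho> = \<rho> and \<kappa> = \<kappa> and t = t])
    show "plane z a b \<Longrightarrow> plane (z(l := e)) a b \<Longrightarrow> \<rho> a = t" for a b
      using t par by blast
  qed (rule plane_bal pl)+
  have colour: "plane_colour (z(l := f)) a b = (if plane z a b then \<rho> a else t)"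
    if "plane (z(l := f)) a b" for f a b
    using par[OF _ that] t[of a b] Pe[of a b] plane_parallel(2)[OF l that, of e] by auto
  have dich: "(\<forall>a b. plane (z(l := f)) a b \<longleftrightarrow> plane z a b) \<or> (\<forall>a b. plane (z(l := f)) a b \<longleftrightarrow> \<not> plane z a b)" for f
  proof (rule equal_or_opposite_plane[where \<rho> = \<rho> and \<kappa> = \<kappa> and t = t])
    show "plane (z(l := f)) a b \<Longrightarrow> line_colour j (z(l := f, i := a)) = (if plane z a b then \<rho> a else t)" for a b
      by (simp only: plane_line_colour(1) colour)
    show "plane (z(l := f)) a b \<Longrightarrow> line_colour i (z(l := f, j := b)) = (if plane z a b then \<rho> a else t)" for a b
      by (simp only: plane_line_colour(2) colour)
  qed (rule plane_bal pl)+
  \<comment> \<open>Over a cell of the plane at \<open>z\<close>, the \<open>l\<close>-line contains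
    the point at \<open>z l\<close> and misses the one at \<open>e\<close>. Balance supplies a
    second code point, and the dichotomy extends agreement at this cell to the whole plane.\<close>
  obtain e' where e': "e' \<noteq> e" "e' \<noteq> z l" "\<And>a b. plane (z(l := e')) a b \<longleftrightarrow> plane z a b"
  proof -
    obtain b where ab: "plane z L0 b" using bal_ex[OF plane_bal(1), of z L0 True] by auto
    have "\<not> plane (z(l := e)) L0 b" "plane (z(l := z l)) L0 b" using Pe ab by auto
    then have "\<exists>e'. e' \<noteq> e \<and> e' \<noteq> z l \<and> plane (z(l := e')) L0 b"
      using plane_parallel(1)[OF l, of z L0 b] unfolding bal_iff ex_letter
      by (cases e; cases "z l") (simp_all split: if_splits)
    then show ?thesis using dich ab that by blast
  qed
  have "line_colour j (z(l := e', i := a)) = \<rho> a" for a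
  proof -
    obtain b where "plane z a b" using bal_ex[OF plane_bal(1), of z a True] by auto
    then show ?thesis using par e'(3) plane_line_colour(1) by blast
  qed
  moreover have "line_colour i (z(l := e', j := b)) = \<kappa> b" for b
  proof -
    obtain a where "plane z a b" using bal_ex[OF plane_bal(2), of z b True] by auto
    then show ?thesis using par[of a b e'] e'(3) plane_line_colour(2)[of "z(l := e')" a b] pl[of a b] by simp
  qed
  ultimately have "mixed (z(l := e'))" using z unfolding mixed_def \<rho>_def \<kappa>_def by simp
  then show ?thesis using e' by blast
qed

lemma indec_not_mixed:
  assumes ind: "indec F i j"
  shows "\<not> mixed z"
proof
  assume Nz: "mixed z"
  obtain z0 a0 b0 where z0: "(F z0 = F (z0(i := a0))) \<noteq> (F (z0(j := b0)) = F (z0(i := a0, j := b0)))"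
    using ind unfolding indec_def by blast
  \<comment> \<open>Coordinates \<open>i\<close> and \<open>j\<close> are left out because the plane
    does not depend on them.\<close>
  define D where "D z = {l \<in> I - {i, j}. z l \<noteq> z0 l}" for z
  have finD: "finite (D z)" for z using finI by (simp add: D_def)
  define m where "m = (LEAST m. \<exists>z. mixed z \<and> card (D z) = m)"
  have "\<exists>z. mixed z \<and> card (D z) = m"
    unfolding m_def by (rule LeastI_ex) (use Nz in blast)
  then obtain z1 where z1: "mixed z1" "card (D z1) = m" by blast
  have least: "m \<le> card (D z)" if "mixed z" for z
    unfolding m_def by (rule Least_le) (use that in blast)
  \<comment> \<open>The claim ranges over all mixed \<open>z\<close> at minimal distance, since the
    induction uses it both for \<open>z\<close> and for the equal plane at \<open>z(l := e)\<close>.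
    After replacing \<open>T\<close> these two still agree, so the third letter \<open>z0 l\<close>
    must carry the complement.\<close>
  have flip: "plane (override_on z z0 T) a b \<longleftrightarrow> (plane z a b \<noteq> odd (card T))"
    if "finite T" "mixed z" "card (D z) = m" "T \<subseteq> D z" for z T a b
    using that
  proof (induction T arbitrary: z rule: finite_induct)
    case empty
    then show ?case by simp
  next
    case (insert l T)
    have l: "l \<in> D z" "l \<in> I" "l \<noteq> i" "l \<noteq> j" "z l \<noteq> z0 l" using insert.prems by (auto simp: D_def)
    have "D (z(l := z0 l)) = D z - {l}" by (auto simp: D_def)
    then have "card (D (z(l := z0 l))) < m"
      using l(1) insert.prems(2) finD by (metis card_Diff1_less)
    then have "\<not> mixed (z(l := z0 l))" using least leD by blast
    then obtain e where e: "e \<noteq> z0 l" "e \<noteq> z l" "mixed (z(l := e))" "\<And>a b. plane (z(l := e)) a b = plane z a b"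
      using mixed_step[OF insert.prems(1) l(2-4)] by blast
    define w where "w = override_on z z0 T"
    have "D (z(l := e)) = D z" using l e by (auto simp: D_def)
    moreover have "override_on (z(l := e)) z0 T = w(l := e)"
      using insert.hyps by (auto simp: fun_eq_iff override_on_def w_def)
    ultimately have we: "plane (w(l := e)) a b \<longleftrightarrow> (plane z a b \<noteq> odd (card T))"
      using insert.IH[OF e(3)] insert.prems(2,3) by (simp only: e(4) insert_subset)
    have w: "plane w a b \<longleftrightarrow> (plane z a b \<noteq> odd (card T))"
      unfolding w_def using insert.IH[OF insert.prems(1,2)] insert.prems(3) by simp
    have "bal (\<lambda>f. plane (w(l := f)) a b)" using plane_parallel(1) l(2-4) .
    moreover have "w(l := z l) = w" using insert.hyps by (auto simp: w_def)
    ultimately have "plane (w(l := z0 l)) a b \<longleftrightarrow> \<not> plane w a b"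
      using bal_flip[of "\<lambda>f. plane (w(l := f)) a b" "z l" e "z0 l"] w we e l by auto
    moreover have "override_on z z0 (insert l T) = w(l := z0 l)"
      by (auto simp: fun_eq_iff override_on_def w_def)
    moreover have "odd (card (insert l T)) = even (card T)" using insert.hyps by simp
    ultimately show ?case using w by argo
  qed
  have "plane z0 a b \<longleftrightarrow> (plane z1 a b \<noteq> odd (card (D z1)))" for a b
  proof -
    have "plane (override_on z1 z0 (D z1)) a b = plane z0 a b"
      unfolding plane_def by (rule dep) (auto simp: D_def override_on_def)
    then show ?thesis using flip[OF finD z1] by auto
  qed
  \<comment> \<open>The plane through \<open>z0\<close> now splits into a row part and a column
    part, against the choice of \<open>z0\<close>.\<close>
  then have sep: "plane z0 a b \<longleftrightarrow> ((line_colour j (z1(i := a)) = line_colour i (z1(j := b))) \<noteq> odd (card (D z1)))" for a b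
    using mixed_plane[OF z1(1)] by simp
  have "plane z0 (z0 i) (z0 j) = F z0" "plane z0 a0 (z0 j) = F (z0(i := a0))" "plane z0 (z0 i) b0 = F (z0(j := b0))"
    unfolding plane_def using ij by (auto intro!: arg_cong[where f = F])
  then show False
    using z0 sep[of "z0 i" "z0 j"] sep[of "z0 i" b0] sep[of a0 "z0 j"] sep[of a0 b0]
    unfolding plane_def[of z0 a0 b0] by argo
qed

lemma line_colour_indec: "indec F i j \<Longrightarrow> line_colour i z = line_colour j z"
  using indec_not_mixed[of z] fun_upd_triv[of z i] fun_upd_triv[of z j] unfolding mixed_def by metis

end

lemma line_colour_indec_rtrancl: "(indec F)\<^sup>*\<^sup>* i j \<Longrightarrow> line_colour i z = line_colour j z"
proof (induction rule: rtranclp_induct)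
  case (step y w)
  then show ?case using line_colour_indec[of y w z] indec_in by (cases "y = w") auto
qed simp

text \<open>Moving from \<open>x\<close> to \<open>y\<close> letter by letter may leave the code, so
  the colour of lines is tracked instead of the colour of points. Changing letter \<open>l\<close>
  keeps \<open>line_colour l\<close>, and linkage identifies it with \<open>line_colour i\<close>
  for one fixed \<open>i\<close>.\<close>

lemma connected_block:
  assumes "K \<subseteq> I" and K: "\<And>i j. i \<in> K \<Longrightarrow> j \<in> K \<Longrightarrow> (indec F)\<^sup>*\<^sup>* i j"
    and "F x" "F y" and agree: "\<And>i. i \<notin> K \<Longrightarrow> x i = y i"
  shows "c x = c y"
proof (cases "K = {}")
  case True
  then have "x = y" using agree by auto
  then show ?thesis by simp
next
  case False
  then obtain i where i: "i \<in> K" by blast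
  have "line_colour i (override_on x y T) = line_colour i x" if "finite T" "T \<subseteq> K" for T
    using that
  proof (induction T rule: finite_induct)
    case (insert l T)
    have "override_on x y (insert l T) = (override_on x y T)(l := y l)"
      by (auto simp: override_on_def)
    then have "line_colour l (override_on x y (insert l T)) = line_colour l (override_on x y T)" by simp
    then show ?case using insert line_colour_indec_rtrancl K[of i l] i by auto
  qed simp
  moreover have "override_on x y K = y" using agree by (auto simp: override_on_def)
  ultimately have "line_colour i y = line_colour i x" using assms(1) finI by (metis finite_subset order_refl)
  then show ?thesis using line_colour_eq i assms by (metis subsetD)
qed

end

section \<open>Separation of unlinked coordinates\<close>

text \<open>Change the letters in \<open>V\<close> one at a time: every rectangle with sides in
  directions \<open>u\<close> and \<open>v\<close> has vanishing mixed difference, and these add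
  up.\<close>

lemma separate1:
  assumes "finite V" "u \<notin> V" "\<And>v. v \<in> V \<Longrightarrow> \<not> indec F u v"
  shows "(F x = F (override_on x y V)) = (F (x(u := a)) = F (override_on (x(u := a)) y V))"
  using assms
proof (induction V rule: finite_induct)
  case (insert v V)
  define w where "w = override_on x y V"
  have eqs: "override_on x y (insert v V) = w(v := y v)"
    "override_on (x(u := a)) y (insert v V) = w(u := a, v := y v)"
    "override_on (x(u := a)) y V = w(u := a)"
    using insert.prems by (auto simp: fun_eq_iff override_on_def w_def)
  have "(F w = F (w(u := a))) = (F (w(v := y v)) = F (w(u := a, v := y v)))"
    using insert.prems(2)[of v] unfolding indec_def by blast
  moreover have "(F x = F w) = (F (x(u := a)) = F (w(u := a)))"
    unfolding w_def eqs(3)[unfolded w_def, symmetric] using insert by blast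
  ultimately show ?case unfolding eqs by blast
qed simp

lemma separate:
  assumes "finite U" "finite V" "U \<inter> V = {}" "\<And>u v. u \<in> U \<Longrightarrow> v \<in> V \<Longrightarrow> \<not> indec F u v"
  shows "(F x = F (override_on x y V)) =
    (F (override_on x y' U) = F (override_on (override_on x y' U) y V))"
  using assms(1,3,4)
proof (induction U rule: finite_induct)
  case (insert u U)
  have eq: "override_on x y' (insert u U) = (override_on x y' U)(u := y' u)"
    by (auto simp: fun_eq_iff override_on_def)
  have "(F (override_on x y' U) = F (override_on (override_on x y' U) y V)) =
      (F ((override_on x y' U)(u := y' u)) = F (override_on ((override_on x y' U)(u := y' u)) y V))"
    using insert.prems by (intro separate1 assms(2)) auto
  moreover have "(F x = F (override_on x y V)) =
      (F (override_on x y' U) = F (override_on (override_on x y' U) y V))"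
    using insert by blast
  ultimately show ?case unfolding eq by blast
qed simp

section \<open>Words indexed by a set of coordinates\<close>

primrec enc :: "letter \<Rightarrow> nat" where
  "enc L0 = 0" | "enc L1 = 1" | "enc L2 = 2" | "enc L3 = 3"

lemma inj_enc: "inj enc"
proof (rule injI)
  show "enc a = enc b \<Longrightarrow> a = b" for a b by (cases a; cases b) simp_all
qed

lemma enc_eq [simp]: "enc a = enc b \<longleftrightarrow> a = b"
  using inj_enc by (auto dest: injD)

lemma enc_less [simp]: "enc a < 4"
  by (cases a) simp_all

lemma enc_surj: "m < 4 \<Longrightarrow> \<exists>a. m = enc a"
  unfolding ex_letter by auto

text \<open>The coordinates in \<open>K\<close>, read in increasing order, so that \<open>nths\<close> of a full word is again of this
  form (lemma \<open>nths_wd\<close>).\<close>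

definition wd :: "nat set \<Rightarrow> (nat \<Rightarrow> letter) \<Rightarrow> nat list" where
  "wd K x = map (\<lambda>i. enc (x i)) (sorted_list_of_set K)"

lemma finite_words: "finite (words m)"
  unfolding words_def using finite_lists_length_eq[of "{0..<4::nat}" m] by (simp add: conj_commute)

lemma wd_in_words [simp]: "wd K x \<in> words (card K)"
  by (auto simp: wd_def words_def)

lemma wd_eq_iff: "finite K \<Longrightarrow> wd K x = wd K y \<longleftrightarrow> (\<forall>i\<in>K. x i = y i)"
  by (simp add: wd_def)

lemma words_wd:
  assumes "finite K" "w \<in> words (card K)"
  obtains x where "w = wd K x"
proof -
  let ?xs = "sorted_list_of_set K"
  have len: "length w = length ?xs" "set w \<subseteq> {0..<4}" using assms by (auto simp: words_def)
  have "\<exists>a. p < card K \<longrightarrow> enc a = w ! p" for p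
    using len enc_surj[of "w ! p"] nth_mem[of p w] by fastforce
  then obtain f where f: "\<And>p. p < card K \<Longrightarrow> enc (f p) = w ! p" by metis
  \<comment> \<open>The inverse of \<open>nth\<close> gives the position of \<open>i\<close> in the
    sorted list of \<open>K\<close>.\<close>
  define x where "x i = f (the_inv_into {..<card K} ((!) ?xs) i)" for i
  have inj: "inj_on ((!) ?xs) {..<card K}"
    by (auto intro!: inj_on_nth)
  have "w = wd K x"
    by (rule nth_equalityI) (use len f in \<open>auto simp: wd_def x_def the_inv_into_f_f[OF inj]\<close>)
  then show thesis using that by blast
qed

lemma nth_sorted_list_of_set:
  assumes "finite K" "i \<in> K"
  obtains p where "p < card K" "sorted_list_of_set K ! p = i"
  using assms by (metis in_set_conv_nth length_sorted_list_of_set set_sorted_list_of_set)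

lemma wd_upd:
  assumes "p < card K"
  shows "wd K (x(sorted_list_of_set K ! p := a)) = (wd K x)[p := enc a]"
proof (rule nth_equalityI)
  fix q assume "q < length (wd K (x(sorted_list_of_set K ! p := a)))"
  then show "wd K (x(sorted_list_of_set K ! p := a)) ! q = (wd K x)[p := enc a] ! q"
    using assms by (auto simp: wd_def nth_list_update nth_eq_iff_index_eq)
qed (simp add: wd_def)

lemma wd_upd_out: "finite K \<Longrightarrow> i \<notin> K \<Longrightarrow> wd K (x(i := a)) = wd K x"
  by (simp add: wd_eq_iff)

lemma nth_wd: "p < card K \<Longrightarrow> wd K x ! p = enc (x (sorted_list_of_set K ! p))"
  by (simp add: wd_def)

lemma card_line_wd:
  assumes p: "p < card K"
  shows "card (A \<inter> line (wd K x) p) = card {a. wd K (x(sorted_list_of_set K ! p := a)) \<in> A}"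
proof -
  have "line (wd K x) p = range (\<lambda>a. wd K (x(sorted_list_of_set K ! p := a)))"
    unfolding line_def wd_upd[OF p] using enc_surj by fastforce
  then have *: "A \<inter> line (wd K x) p = (\<lambda>a. wd K (x(sorted_list_of_set K ! p := a))) `
      {a. wd K (x(sorted_list_of_set K ! p := a)) \<in> A}"
    by auto
  have "p < length (wd K x)" using p by (simp add: wd_def)
  then have "inj (\<lambda>a. wd K (x(sorted_list_of_set K ! p := a)))"
    unfolding wd_upd[OF p] by (metis (lifting) enc_eq injI nth_list_update_eq)
  then show ?thesis
    unfolding * by (rule card_image[OF inj_on_subset]) simp
qed

text \<open>The condition \<open>Q\<close> on the cardinality stays abstract so that double-codes
  and double-MDS-codes are both covered.\<close>

lemma all_lines_wd:
  assumes K: "finite K"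
  shows "(\<forall>w\<in>words (card K). \<forall>p<card K. Q (card (A \<inter> line w p))) \<longleftrightarrow>
    (\<forall>x. \<forall>i\<in>K. Q (card {a. wd K (x(i := a)) \<in> A}))" (is "?L \<longleftrightarrow> ?R")
proof
  assume ?L
  show ?R
  proof (intro allI ballI)
    fix x i assume "i \<in> K"
    with K obtain p where "p < card K" "sorted_list_of_set K ! p = i" by (rule nth_sorted_list_of_set)
    then show "Q (card {a. wd K (x(i := a)) \<in> A})"
      using \<open>?L\<close> card_line_wd[of p K A x] wd_in_words by metis
  qed
next
  assume ?R
  show ?L
  proof (intro ballI allI impI)
    fix w p assume "w \<in> words (card K)" and p: "p < card K"
    then obtain x where x: "w = wd K x" using K words_wd by blast
    have "sorted_list_of_set K ! p \<in> K"
      using p K by (metis length_sorted_list_of_set nth_mem set_sorted_list_of_set)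
    then show "Q (card (A \<inter> line w p))" using \<open>?R\<close> card_line_wd[OF p] x by simp
  qed
qed

lemma double_MDS_wd:
  "finite K \<Longrightarrow> double_MDS (card K) S \<longleftrightarrow>
    S \<subseteq> words (card K) \<and> (\<forall>x. \<forall>i\<in>K. bal (\<lambda>a. wd K (x(i := a)) \<in> S))"
  unfolding double_MDS_def bal_def
  using all_lines_wd[where Q = "\<lambda>m. m = 2" and K = K and A = S] by simp

lemma double_code_wd:
  "finite K \<Longrightarrow> double_code (card K) A \<longleftrightarrow> A \<subseteq> words (card K) \<and>
    (\<forall>x. \<forall>i\<in>K. card {a. wd K (x(i := a)) \<in> A} = 0 \<or> card {a. wd K (x(i := a)) \<in> A} = 2)"
  unfolding double_code_def
  using all_lines_wd[where Q = "\<lambda>m. m = 0 \<or> m = 2" and K = K and A = A] by simp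

lemma adj_sym: "adj x y \<Longrightarrow> adj y x"
  by (simp add: adj_def eq_commute)

lemma adj_wd_iff:
  assumes K: "finite K"
  shows "adj (wd K x) (wd K y) \<longleftrightarrow> (\<exists>i\<in>K. x i \<noteq> y i \<and> wd K y = wd K (x(i := y i)))"
proof -
  let ?xs = "sorted_list_of_set K"
  have bij: "bij_betw ((!) ?xs) {..<card K} K"
    using bij_betw_nth[of ?xs "{..<card K}" K] K by simp
  have "{i\<in>K. x i \<noteq> y i} = (!) ?xs ` {p. p < card K \<and> x (?xs ! p) \<noteq> y (?xs ! p)}"
    using bij unfolding bij_betw_def by auto
  then have "card {i\<in>K. x i \<noteq> y i} = card {p. p < card K \<and> x (?xs ! p) \<noteq> y (?xs ! p)}"
    by (simp add: card_image[OF inj_on_subset[OF bij_betw_imp_inj_on[OF bij]]] subset_eq)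
  moreover have "{p. p < card K \<and> wd K x ! p \<noteq> wd K y ! p} = {p. p < card K \<and> x (?xs ! p) \<noteq> y (?xs ! p)}"
    by (auto simp: nth_wd)
  moreover have "length (wd K x) = card K" "length (wd K y) = card K" by (simp_all add: wd_def)
  ultimately have "adj (wd K x) (wd K y) \<longleftrightarrow> card {i\<in>K. x i \<noteq> y i} = 1"
    by (simp add: adj_def)
  also have "\<dots> \<longleftrightarrow> (\<exists>i. {i\<in>K. x i \<noteq> y i} = {i})" by (rule card_1_singleton_iff[unfolded One_nat_def[symmetric]])
  also have "\<dots> \<longleftrightarrow> (\<exists>i\<in>K. x i \<noteq> y i \<and> wd K y = wd K (x(i := y i)))"
    unfolding wd_eq_iff[OF K] by (auto simp: set_eq_iff) metis+
  finally show ?thesis .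
qed

lemma nths_upt: "K \<subseteq> {0..<n} \<Longrightarrow> nths [0..<n] K = sorted_list_of_set K"
proof -
  assume K: "K \<subseteq> {0..<n}"
  have "set (nths [0..<n] K) = K" using K by (auto simp: set_nths intro!: exI)
  moreover have "sorted (nths [0..<n] K)" "distinct (nths [0..<n] K)"
    by (simp_all add: sorted_nths distinct_nthsI)
  ultimately show ?thesis
    by (metis sorted_list_of_set.idem_if_sorted_distinct)
qed

lemma nths_wd: "K \<subseteq> {0..<n} \<Longrightarrow> nths (wd {0..<n} x) K = wd K x"
  by (simp add: wd_def nths_map nths_upt)

section \<open>The adjacency graph of a double-MDS-code\<close>

lemma reach_refl [simp]: "reach S x x"
  by (simp add: reach_def)

lemma reach_trans: "reach S x y \<Longrightarrow> reach S y z \<Longrightarrow> reach S x z"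
  unfolding reach_def by (rule rtranclp_trans)

lemma reach_sym: "reach S x y \<Longrightarrow> reach S y x"
  unfolding reach_def
proof (induction rule: rtranclp_induct)
  case (step y z)
  then show ?case by (auto intro: converse_rtranclp_into_rtranclp adj_sym)
qed simp

lemma reach_adj: "x \<in> S \<Longrightarrow> y \<in> S \<Longrightarrow> adj x y \<Longrightarrow> reach S x y"
  unfolding reach_def by blast

lemma reach_in: "reach S x y \<Longrightarrow> x \<in> S \<Longrightarrow> y \<in> S"
  unfolding reach_def by (induction rule: rtranclp_induct) auto

lemma reach_invariant:
  assumes "reach S x y" "h x" "\<And>x y. x \<in> S \<Longrightarrow> y \<in> S \<Longrightarrow> adj x y \<Longrightarrow> h x \<Longrightarrow> h y"
  shows "h y"
  using assms(1,2) unfolding reach_def by (induction rule: rtranclp_induct) (auto intro: assms(3))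

lemma is_partition_components: "is_partition (components S) S"
  unfolding is_partition_def components_def
proof (intro conjI ballI impI)
  show "\<Union> {{y \<in> S. reach S x y} |x. x \<in> S} = S" using reach_refl by blast
  show "{} \<notin> {{y \<in> S. reach S x y} |x. x \<in> S}" by auto
next
  fix A B
  assume "A \<in> {{y \<in> S. reach S x y} |x. x \<in> S}" "B \<in> {{y \<in> S. reach S x y} |x. x \<in> S}" "A \<noteq> B"
  then obtain x y where A: "A = {z \<in> S. reach S x z}" and B: "B = {z \<in> S. reach S y z}" by auto
  show "A \<inter> B = {}"
  proof (rule ccontr)
    assume "A \<inter> B \<noteq> {}"
    then obtain z where "reach S x z" "reach S y z" unfolding A B by auto
    then have "reach S x w \<longleftrightarrow> reach S y w" for w by (meson reach_sym reach_trans)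
    then show False using \<open>A \<noteq> B\<close> A B by auto
  qed
qed

text \<open>Freezing the letters off \<open>L\<close> at \<open>z\<close> embeds \<open>D\<close>
  into \<open>T\<close> and preserves adjacency, so a 2-colouring of \<open>T\<close> pulls back to
  \<open>D\<close>.\<close>

lemma bipartite_embed:
  assumes "finite I" "L \<subseteq> I" "bipartite T" and D: "D \<subseteq> words (card L)"
    and T: "\<And>x. wd L x \<in> D \<Longrightarrow> wd I (override_on z x L) \<in> T"
  shows "bipartite D"
proof -
  have L: "finite L" using assms(1,2) finite_subset by blast
  obtain c :: "nat list \<Rightarrow> bool" where c: "\<And>x y. x \<in> T \<Longrightarrow> y \<in> T \<Longrightarrow> adj x y \<Longrightarrow> c x \<noteq> c y"
    using assms(3) unfolding bipartite_def by blast
  have wd_override: "wd I (override_on z x L) = wd I (override_on z y L)" if "wd L x = wd L y" for x y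
    using that L assms(1,2) by (auto simp: wd_eq_iff override_on_def)
  define c' where "c' w \<longleftrightarrow> (\<exists>x. w = wd L x \<and> c (wd I (override_on z x L)))" for w
  have c': "c' (wd L x) = c (wd I (override_on z x L))" for x
    unfolding c'_def using wd_override by metis
  have "c' v \<noteq> c' w" if vw: "v \<in> D" "w \<in> D" "adj v w" for v w
  proof -
    obtain x where x: "v = wd L x" using words_wd[OF L] vw(1) D by blast
    obtain y where y: "w = wd L y" using words_wd[OF L] vw(2) D by blast
    note xy = x y
    then obtain i where i: "i \<in> L" "x i \<noteq> y i" "wd L y = wd L (x(i := y i))"
      using vw adj_wd_iff[OF L] by blast
    have "y l = x l" if "l \<in> L" "l \<noteq> i" for l using i(3) that unfolding wd_eq_iff[OF L] by force
    then have "\<forall>l\<in>I. override_on z y L l = ((override_on z x L)(i := override_on z y L i)) l"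
      by (simp add: override_on_def)
    then have "adj (wd I (override_on z x L)) (wd I (override_on z y L))"
      unfolding adj_wd_iff[OF assms(1)] wd_eq_iff[OF assms(1)]
      using i(1,2) assms(2) by (intro bexI[of _ i] conjI) auto
    then show ?thesis using c T vw(1,2) unfolding xy c' by blast
  qed
  then show ?thesis unfolding bipartite_def by blast
qed

section \<open>Primality as connectedness of the adjacency graph\<close>

locale mds =
  fixes K :: "nat set" and S :: "nat list set"
  assumes finK: "finite K" and mds: "double_MDS (card K) S"
begin

lemma S_words: "S \<subseteq> words (card K)"
  using mds by (simp add: double_MDS_def)

lemma finite_S: "finite S"
  by (rule finite_subset[OF S_words finite_words])

sublocale balanced K "\<lambda>x. wd K x \<in> S"
proof
  show "(\<And>i. i \<in> K \<Longrightarrow> x i = y i) \<Longrightarrow> (wd K x \<in> S) = (wd K y \<in> S)" for x y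
    using wd_eq_iff[OF finK, of x y] by simp
  show "i \<in> K \<Longrightarrow> bal (\<lambda>a. wd K (x(i := a)) \<in> S)" for x i
    using mds double_MDS_wd[OF finK] by blast
qed (rule finK)

lemma adj_upd: "i \<in> K \<Longrightarrow> x i \<noteq> a \<Longrightarrow> adj (wd K x) (wd K (x(i := a)))"
  unfolding adj_wd_iff[OF finK] by auto

lemma reach_upd:
  assumes "i \<in> K" "wd K (x(i := a)) \<in> S" "wd K (x(i := b)) \<in> S"
  shows "reach S (wd K (x(i := a))) (wd K (x(i := b)))"
  using assms adj_upd[OF assms(1), of "x(i := a)" b] by (cases "a = b") (auto intro: reach_adj)

text \<open>Being reachable from \<open>wd K x\<close> is a colouring: two code words on a common
  line are adjacent or equal.\<close>

lemma reach_block: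
  assumes "L \<subseteq> K" "\<And>i j. i \<in> L \<Longrightarrow> j \<in> L \<Longrightarrow> (indec (\<lambda>x. wd K x \<in> S))\<^sup>*\<^sup>* i j"
    and "wd K x \<in> S" "wd K y \<in> S" "\<And>i. i \<notin> L \<Longrightarrow> x i = y i"
  shows "reach S (wd K x) (wd K y)"
proof -
  interpret colouring K "\<lambda>x. wd K x \<in> S" "\<lambda>y. reach S (wd K x) (wd K y)"
    by unfold_locales (meson reach_upd reach_trans)
  show ?thesis using connected_block[OF assms] by simp
qed

text \<open>A line that meets \<open>B\<close> does so in two points. These are all its points in
  \<open>S\<close>, so no edge of \<open>S\<close> leaves \<open>B\<close>.\<close>

lemma code_closed:
  assumes B: "double_code (card K) B" "B \<subseteq> S" and "b \<in> B" "reach S b y"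
  shows "y \<in> B"
proof (rule reach_invariant[where h = "\<lambda>y. y \<in> B", OF assms(4,3)])
  fix v w assume vw: "v \<in> S" "w \<in> S" "adj v w" "v \<in> B"
  obtain x where x: "v = wd K x" using words_wd[OF finK] vw(1) S_words by blast
  obtain y where y: "w = wd K y" using words_wd[OF finK] vw(2) S_words by blast
  note xy = x y
  then obtain i where i: "i \<in> K" "wd K y = wd K (x(i := y i))"
    using vw adj_wd_iff[OF finK] by blast
  let ?B = "{a. wd K (x(i := a)) \<in> B}" and ?S = "{a. wd K (x(i := a)) \<in> S}"
  have "x i \<in> ?B" using vw xy by simp
  then have "card ?B \<noteq> 0" unfolding card_0_eq[OF finite_letter] by (metis empty_iff)
  moreover have "card ?B = 0 \<or> card ?B = 2"
    using B(1) i(1) unfolding double_code_wd[OF finK] by (elim conjE allE[of _ x] ballE[of _ _ i]) simp_all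
  ultimately have "card ?B = 2" by linarith
  moreover have "card ?S = 2" using bal[OF i(1)] by (simp add: bal_def)
  ultimately have "?B = ?S" using B(2) finite_letter by (intro card_subset_eq) auto
  moreover have "y i \<in> ?S" using vw(2) xy i(2) by simp
  ultimately have "y i \<in> ?B" by (simp only:)
  then show "w \<in> B" using xy i(2) by simp
qed

lemma double_code_component:
  assumes "A \<in> components S"
  shows "double_code (card K) A"
  unfolding double_code_wd[OF finK]
proof (intro conjI allI ballI)
  obtain w where A: "A = {y \<in> S. reach S w y}" using assms by (auto simp: components_def)
  show "A \<subseteq> words (card K)" using A S_words by auto
  fix x i assume i: "i \<in> K"
  show "card {a. wd K (x(i := a)) \<in> A} = 0 \<or> card {a. wd K (x(i := a)) \<in> A} = 2"
  proof (cases "\<exists>a. wd K (x(i := a)) \<in> A")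
    case True
    then have "wd K (x(i := a)) \<in> A \<longleftrightarrow> wd K (x(i := a)) \<in> S" for a
      unfolding A using reach_upd[OF i] by (auto intro: reach_trans)
    then show ?thesis using bal[OF i] by (simp add: bal_def)
  qed simp
qed

text \<open>By \<open>code_closed\<close>, each part of a partition into double-codes already
  contains the whole component.\<close>

lemma prime_component:
  assumes "A \<in> components S"
  shows "prime_code (card K) A"
  unfolding prime_code_def complementable_def
proof (intro conjI notI)
  obtain w where A: "A = {y \<in> S. reach S w y}" "w \<in> S" using assms by (auto simp: components_def)
  show "double_code (card K) A" using double_code_component[OF assms] .
  show "\<exists>T. double_MDS (card K) T \<and> A \<subseteq> T" using mds A by auto
  show False if "A = {}" using that A by auto
  show False if ex: "\<exists>P. is_partition P A \<and> finite P \<and> 2 \<le> card P \<and> (\<forall>B\<in>P. double_code (card K) B)"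
  proof -
    obtain P where P: "is_partition P A" "2 \<le> card P" "\<And>B. B \<in> P \<Longrightarrow> double_code (card K) B"
      using ex by blast
    have "B = A" if B: "B \<in> P" for B
    proof
      show "B \<subseteq> A" using P(1) B by (auto simp: is_partition_def)
      have "B \<noteq> {}" using P(1) B by (auto simp: is_partition_def)
      then obtain b where b: "b \<in> B" by blast
      show "A \<subseteq> B"
      proof
        fix y assume "y \<in> A"
        then have "reach S b y" using b \<open>B \<subseteq> A\<close> A by (blast intro: reach_trans reach_sym)
        moreover have "B \<subseteq> S" using \<open>B \<subseteq> A\<close> A by auto
        ultimately show "y \<in> B" using code_closed P(3) B b by blast
      qed
    qed
    then have "P \<subseteq> {A}" by blast
    then have "card P \<le> 1" using card_mono[of "{A}" P] by simp
    then show False using P(2) by simp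
  qed
qed

text \<open>Two different components would make the set of components a forbidden partition into
  double-codes.\<close>

lemma prime_connected:
  assumes "prime_code (card K) S" "v \<in> S" "w \<in> S"
  shows "reach S v w"
proof (rule ccontr)
  assume "\<not> reach S v w"
  then have "w \<notin> {y \<in> S. reach S v y}" by blast
  moreover have "w \<in> {y \<in> S. reach S w y}" using assms by simp
  ultimately have ne: "{y \<in> S. reach S v y} \<noteq> {y \<in> S. reach S w y}" by blast
  have fin: "finite (components S)"
    using finite_S by (simp add: components_def)
  have "{{y \<in> S. reach S v y}, {y \<in> S. reach S w y}} \<subseteq> components S"
    unfolding components_def using assms(2,3) by blast
  from card_mono[OF fin this] have "2 \<le> card (components S)" using ne by simp
  moreover have "\<forall>A\<in>components S. double_code (card K) A" using double_code_component by blast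
  ultimately show False
    using assms(1) fin is_partition_components[of S] unfolding prime_code_def by blast
qed

lemma connected_prime:
  assumes "v \<in> S" "\<And>w. w \<in> S \<Longrightarrow> reach S v w"
  shows "prime_code (card K) S"
proof (rule prime_component)
  show "S \<in> components S" unfolding components_def using assms by blast
qed

end

section \<open>Blocks and factors\<close>

definition zero :: "nat \<Rightarrow> letter" where
  "zero i = L0"

lemma wd_zero: "wd K zero = replicate (card K) 0"
  by (simp add: wd_def zero_def map_replicate_const)

definition block :: "((nat \<Rightarrow> letter) \<Rightarrow> bool) \<Rightarrow> nat \<Rightarrow> nat set" where
  "block F i = {j. (indec F)\<^sup>*\<^sup>* i j}"

text \<open>The slice through the zero assignment in the directions of \<open>L\<close>,
  complemented if necessary so that it contains the zero word.\<close>

definition factor :: "((nat \<Rightarrow> letter) \<Rightarrow> bool) \<Rightarrow> nat set \<Rightarrow> nat list set" where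
  "factor F L = {wd L x | x. F (override_on zero x L) = F zero}"

lemma wd_in_factor:
  assumes "finite L"
  shows "wd L x \<in> factor F L \<longleftrightarrow> F (override_on zero x L) = F zero"
proof -
  have "override_on zero x L = override_on zero y L" if "wd L x = wd L y" for y
    using that unfolding wd_eq_iff[OF assms] by (simp add: fun_eq_iff override_on_def)
  then show ?thesis unfolding factor_def by (smt (verit) mem_Collect_eq)
qed

lemma factor_words: "factor F L \<subseteq> words (card L)"
  by (auto simp: factor_def)

lemma zero_in_factor: "replicate (card L) 0 \<in> factor F L"
proof -
  have "override_on zero zero L = zero" by (simp add: fun_eq_iff override_on_def)
  then show ?thesis unfolding factor_def mem_Collect_eq by (intro exI[of _ zero]) (simp only: wd_zero)
qed

lemma indec_rtrancl_sym: "(indec F)\<^sup>*\<^sup>* i j \<Longrightarrow> (indec F)\<^sup>*\<^sup>* j i"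
proof (induction rule: rtranclp_induct)
  case (step j l)
  then show ?case using indec_sym converse_rtranclp_into_rtranclp[of "indec F" l j i] by blast
qed simp

lemma block_self: "i \<in> block F i"
  by (simp add: block_def)

lemma block_eq: "j \<in> block F i \<Longrightarrow> block F j = block F i"
  unfolding block_def by (auto intro: indec_rtrancl_sym rtranclp_trans)

context balanced
begin

lemma block_subset: "i \<in> I \<Longrightarrow> block F i \<subseteq> I"
proof
  fix j assume "i \<in> I" "j \<in> block F i"
  then show "j \<in> I" unfolding block_def mem_Collect_eq
    by (metis indec_in rtranclp.cases)
qed

context
  fixes L assumes L: "L \<in> block F ` I"
begin

lemma blocks_subset: "L \<subseteq> I" and blocks_finite: "finite L" and blocks_nonempty: "L \<noteq> {}"
proof -
  obtain i where i: "i \<in> I" "L = block F i" using L by blast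
  show "L \<subseteq> I" using i block_subset by blast
  then show "finite L" using finI finite_subset by blast
  show "L \<noteq> {}" using i block_self by blast
qed

lemma blocks_connected: "i \<in> L \<Longrightarrow> j \<in> L \<Longrightarrow> (indec F)\<^sup>*\<^sup>* i j"
  using L unfolding block_def by (auto intro: indec_rtrancl_sym rtranclp_trans)

lemma blocks_closed: "i \<in> L \<Longrightarrow> j \<notin> L \<Longrightarrow> \<not> indec F i j"
  using L unfolding block_def by (auto dest: rtranclp.rtrancl_into_rtrancl)

text \<open>Coordinates off the block are unlinked to \<open>i\<close>. Setting them to zero does
  not affect whether the change at \<open>i\<close> changes \<open>F\<close>.\<close>

lemma factor_toggle:
  assumes i: "i \<in> L"
  shows "(F x = F (x(i := a))) \<longleftrightarrow> (wd L x \<in> factor F L \<longleftrightarrow> wd L (x(i := a)) \<in> factor F L)"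
proof -
  have out: "F (override_on x zero (I - L)) = F (override_on zero x L)" for x
    by (rule dep) (auto simp: override_on_def)
  have "(F x = F (override_on x zero (I - L))) =
      (F (x(i := a)) = F (override_on (x(i := a)) zero (I - L)))"
    using i finI blocks_closed by (intro separate1) auto
  then show ?thesis unfolding wd_in_factor[OF blocks_finite] out by blast
qed

lemma factor_mds: "double_MDS (card L) (factor F L)"
  unfolding double_MDS_wd[OF blocks_finite]
proof (intro conjI allI ballI)
  fix x i assume i: "i \<in> L"
  have "override_on zero (x(i := a)) L = (override_on zero x L)(i := a)" for a
    using i by (auto simp: override_on_def)
  then show "bal (\<lambda>a. wd L (x(i := a)) \<in> factor F L)"
    unfolding wd_in_factor[OF blocks_finite] bal_eq_const using bal i blocks_subset by auto
qed (rule factor_words)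

text \<open>Linkage is a property of \<open>F\<close>, so the colouring lives on all assignments
  with the same value as \<open>zero\<close>: the colour tells whether the projection to
  \<open>L\<close> is reachable from zero inside the factor. Changes off \<open>L\<close> leave the
  projection alone; changes in \<open>L\<close> are controlled by
  \<open>factor_toggle\<close>.\<close>

lemma factor_prime: "prime_code (card L) (factor F L)"
proof -
  interpret C: mds L "factor F L" by unfold_locales (rule blocks_finite factor_mds)+
  interpret G: balanced I "\<lambda>x. F x = F zero"
  proof
    show "(\<And>i. i \<in> I \<Longrightarrow> x i = y i) \<Longrightarrow> (F x = F zero) = (F y = F zero)" for x y
      using dep[of x y] by simp
    show "i \<in> I \<Longrightarrow> bal (\<lambda>a. F (x(i := a)) = F zero)" for x i
      unfolding bal_eq_const by (rule bal)
  qed (rule finI)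
  interpret G: colouring I "\<lambda>x. F x = F zero" "\<lambda>x. reach (factor F L) (wd L zero) (wd L x)"
  proof
    fix x i a b
    assume i: "i \<in> I" and ab: "F (x(i := a)) = F zero" "F (x(i := b)) = F zero"
    show "reach (factor F L) (wd L zero) (wd L (x(i := a))) =
        reach (factor F L) (wd L zero) (wd L (x(i := b)))"
    proof (cases "i \<in> L")
      case True
      have z: "wd L zero \<in> factor F L" by (simp add: wd_zero zero_in_factor)
      have *: "wd L (x(i := a)) \<in> factor F L \<longleftrightarrow> wd L (x(i := b)) \<in> factor F L"
        using factor_toggle[OF True, of "x(i := a)" b] ab by simp
      show ?thesis
        using * C.reach_upd[OF True, of x a b] C.reach_upd[OF True, of x b a]
          reach_in[OF _ z] by (meson reach_trans)
    next
      case False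
      then show ?thesis by (simp only: wd_upd_out[OF blocks_finite False])
    qed
  qed
  show ?thesis
  proof (rule C.connected_prime[of "wd L zero"])
    show "wd L zero \<in> factor F L" by (simp add: wd_zero zero_in_factor)
    fix w assume w: "w \<in> factor F L"
    then obtain x where x: "w = wd L x" "F (override_on zero x L) = F zero"
      by (auto simp: factor_def)
    have "reach (factor F L) (wd L zero) (wd L zero) =
        reach (factor F L) (wd L zero) (wd L (override_on zero x L))"
      by (rule G.connected_block[OF blocks_subset])
        (use x(2) blocks_connected in \<open>auto simp: indec_eq_const override_on_def\<close>)
    moreover have "wd L (override_on zero x L) = w"
      unfolding x(1) using blocks_finite by (simp add: wd_eq_iff override_on_def)
    ultimately show "reach (factor F L) (wd L zero) w" by simp
  qed
qed

end

lemma blocks_disjoint: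
  "L \<in> block F ` I \<Longrightarrow> L' \<in> block F ` I \<Longrightarrow> L \<noteq> L' \<Longrightarrow> L \<inter> L' = {}"
  using block_eq by blast

lemma Union_blocks: "\<Union> (block F ` I) = I"
  using block_subset block_self by auto

text \<open>By \<open>separate\<close>, filling in one more block toggles \<open>F\<close> exactly
  when the word on that block lies outside its factor.\<close>

lemma parity_blocks:
  assumes "finite \<L>" "\<L> \<subseteq> block F ` I"
  shows "F (override_on zero x (\<Union>\<L>)) = F zero \<longleftrightarrow> even (card {L\<in>\<L>. wd L x \<notin> factor F L})"
  using assms
proof (induction \<L> rule: finite_induct)
  case empty
  then show ?case by simp
next
  case (insert L \<L>)
  have L: "L \<in> block F ` I" and \<L>: "\<L> \<subseteq> block F ` I" using insert.prems by auto
  have disj: "\<Union>\<L> \<inter> L = {}" using blocks_disjoint[OF _ L] \<L> insert.hyps(2) by blast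
  have fin: "finite (\<Union>\<L>)" "finite L" using \<L> insert.hyps(1) blocks_finite L by auto
  have eq: "override_on zero x (\<Union> (insert L \<L>)) = override_on (override_on zero x (\<Union>\<L>)) x L"
    by (auto simp: override_on_def)
  have "(F zero = F (override_on zero x L)) =
      (F (override_on zero x (\<Union>\<L>)) = F (override_on (override_on zero x (\<Union>\<L>)) x L))"
  proof (rule separate[OF fin disj])
    fix u v assume "u \<in> \<Union>\<L>" "v \<in> L"
    then show "\<not> indec F u v" using blocks_closed[OF L, of v u] disj indec_sym[of F u v] by blast
  qed
  then have *: "F (override_on zero x (\<Union> (insert L \<L>))) = F zero \<longleftrightarrow>
      (wd L x \<in> factor F L \<longleftrightarrow> F (override_on zero x (\<Union>\<L>)) = F zero)"
    unfolding eq wd_in_factor[OF fin(2)] by blast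
  have "{M \<in> insert L \<L>. wd M x \<notin> factor F M} =
      (if wd L x \<in> factor F L then {M\<in>\<L>. wd M x \<notin> factor F M} else insert L {M\<in>\<L>. wd M x \<notin> factor F M})"
    by auto
  then show ?case unfolding * using insert by simp
qed

lemma parity: "F x = F zero \<longleftrightarrow> even (card {L \<in> block F ` I. wd L x \<notin> factor F L})"
proof -
  have "F (override_on zero x (\<Union> (block F ` I))) = F x"
    unfolding Union_blocks by (rule dep) (simp add: override_on_def)
  then show ?thesis using parity_blocks[of "block F ` I" x] finI by simp
qed

lemma same_signature:
  assumes "\<And>L. L \<in> block F ` I \<Longrightarrow> wd L x \<in> factor F L \<longleftrightarrow> wd L y \<in> factor F L"
  shows "F x = F y"
proof -
  have "{L \<in> block F ` I. wd L x \<notin> factor F L} = {L \<in> block F ` I. wd L y \<notin> factor F L}"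
    using assms by blast
  then show ?thesis using parity[of x] parity[of y] by metis
qed

end

section \<open>Components\<close>

text \<open>Each line in direction \<open>p\<close> is represented by its word with letter 0 at
  position \<open>p\<close>.\<close>

lemma card_lines:
  assumes "p < m" "A \<subseteq> words m"
  shows "card A = (\<Sum>z | z \<in> words m \<and> z ! p = 0. card (A \<inter> line z p))"
proof -
  note fin = finite_words[of m]
  have finA: "finite A" using assms(2) fin finite_subset by blast
  let ?Z = "{z. z \<in> words m \<and> z ! p = 0}"
  have sub: "(\<lambda>v. v[p := 0]) ` A \<subseteq> ?Z"
    using assms set_update_subset_insert[of _ p "0::nat"] by (fastforce simp: words_def)
  have "{v \<in> A. v[p := 0] = z} = A \<inter> line z p" if z: "z \<in> ?Z" for z
  proof (intro equalityI subsetI)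
    fix v assume "v \<in> {v \<in> A. v[p := 0] = z}"
    then have v: "v \<in> A" "v[p := 0] = z" by auto
    then have "v = z[p := v ! p]" by (metis list_update_id list_update_overwrite)
    moreover have "v ! p < 4" using v(1) assms nth_mem[of p v] by (fastforce simp: words_def)
    ultimately show "v \<in> A \<inter> line z p" using v unfolding line_def by blast
  next
    fix v assume "v \<in> A \<inter> line z p"
    then show "v \<in> {v \<in> A. v[p := 0] = z}" using z unfolding line_def
      by auto (metis list_update_id)
  qed
  then have "(\<Sum>z\<in>?Z. card (A \<inter> line z p)) = (\<Sum>z\<in>?Z. \<Sum>v | v \<in> A \<and> v[p := 0] = z. 1)"
    by (intro sum.cong) auto
  also have "\<dots> = (\<Sum>v\<in>A. 1)" using sub fin finA by (intro sum.group) auto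
  finally show ?thesis by simp
qed

lemma card_halve:
  assumes K: "finite K" "i \<in> K" and A: "A \<subseteq> words (card K)" and B: "B \<subseteq> words (card K)"
    and AB: "\<And>x. card {a. wd K (x(i := a)) \<in> B} = 2 * card {a. wd K (x(i := a)) \<in> A}"
  shows "card B = 2 * card A"
proof -
  obtain p where p: "p < card K" "sorted_list_of_set K ! p = i" using K by (rule nth_sorted_list_of_set)
  have "card (B \<inter> line z p) = 2 * card (A \<inter> line z p)" if z: "z \<in> words (card K)" for z
  proof -
    obtain x where "z = wd K x" using words_wd[OF K(1) z] .
    then show ?thesis using AB[of x] card_line_wd[OF p(1)] p(2) by simp
  qed
  then show ?thesis
    unfolding card_lines[OF p(1) A] card_lines[OF p(1) B] sum_distrib_left by (intro sum.cong) auto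
qed

section \<open>Components described by membership in the factors\<close>

context mds
begin

abbreviation F :: "(nat \<Rightarrow> letter) \<Rightarrow> bool" where
  "F \<equiv> \<lambda>x. wd K x \<in> S"

text \<open>An edge of \<open>S\<close> changes one letter but not the value of \<open>F\<close>, so
  \<open>factor_toggle\<close> protects the factor of that letter's block; the other factors do not
  see the letter.\<close>

lemma reach_signature:
  assumes "reach S (wd K x) (wd K y)" "L \<in> block F ` K"
  shows "wd L x \<in> factor F L \<longleftrightarrow> wd L y \<in> factor F L"
proof -
  have LK: "L \<subseteq> K" and L: "finite L" using blocks_subset blocks_finite assms(2) by auto
  \<comment> \<open>Assignments that encode the same word agree on \<open>L\<close>, so quantifying
    over all of them is consistent.\<close>
  define h where "h w \<longleftrightarrow> (\<forall>u. w = wd K u \<longrightarrow> (wd L x \<in> factor F L \<longleftrightarrow> wd L u \<in> factor F L))" for w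
  have wd: "wd L u = wd L u'" if "wd K u = wd K u'" for u u'
    using that LK unfolding wd_eq_iff[OF finK] wd_eq_iff[OF L] by blast
  have hwd: "h (wd K u) \<longleftrightarrow> (wd L x \<in> factor F L \<longleftrightarrow> wd L u \<in> factor F L)" for u
  proof
    show "h (wd K u) \<Longrightarrow> wd L x \<in> factor F L \<longleftrightarrow> wd L u \<in> factor F L"
      unfolding h_def by (drule spec[of _ u]) (erule mp, rule refl)
    show "wd L x \<in> factor F L \<longleftrightarrow> wd L u \<in> factor F L \<Longrightarrow> h (wd K u)"
      unfolding h_def by (intro allI impI) (drule wd, simp only:)
  qed
  have "h (wd K y)"
  proof (rule reach_invariant[where h = h, OF assms(1)])
    show "h (wd K x)" by (simp add: hwd)
    fix v w assume vw: "v \<in> S" "w \<in> S" "adj v w" "h v"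
    obtain u where u: "v = wd K u" using words_wd[OF finK] vw(1) S_words by blast
    obtain t where t: "w = wd K t" using words_wd[OF finK] vw(2) S_words by blast
    obtain i where i: "i \<in> K" "wd K t = wd K (u(i := t i))"
      using vw(3) unfolding u t adj_wd_iff[OF finK] by blast
    have "wd L u \<in> factor F L \<longleftrightarrow> wd L (u(i := t i)) \<in> factor F L"
    proof (cases "i \<in> L")
      case True
      then show ?thesis using factor_toggle[OF assms(2) True, of u "t i"] vw(1,2) u t i(2) by simp
    next
      case False
      then show ?thesis by (simp only: wd_upd_out[OF L False])
    qed
    then show "h w" using vw(4) unfolding u t i(2) hwd by blast
  qed
  then show ?thesis by (simp add: hwd)
qed

text \<open>Pass from \<open>x\<close> to \<open>y\<close> block by block. The signature never
  changes, so by \<open>same_signature\<close> every stage lies in \<open>S\<close>, and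
  \<open>reach_block\<close> joins consecutive stages.\<close>

lemma signature_reach:
  assumes x: "F x" and sig: "\<And>L. L \<in> block F ` K \<Longrightarrow> wd L x \<in> factor F L \<longleftrightarrow> wd L y \<in> factor F L"
  shows "reach S (wd K x) (wd K y)"
proof -
  have step: "F (override_on x y (\<Union>\<L>)) \<and> reach S (wd K x) (wd K (override_on x y (\<Union>\<L>)))"
    if "finite \<L>" "\<L> \<subseteq> block F ` K" for \<L>
    using that
  proof (induction \<L> rule: finite_induct)
    case empty
    then show ?case using x by simp
  next
    case (insert L \<L>)
    let ?u = "override_on x y (\<Union>\<L>)" and ?v = "override_on x y (\<Union>(insert L \<L>))"
    have L: "L \<in> block F ` K" using insert.prems by auto
    have "F x = F ?v"
    proof (rule same_signature)
      fix M assume M: "M \<in> block F ` K"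
      have fin: "finite M" using blocks_finite[OF M] .
      show "wd M x \<in> factor F M \<longleftrightarrow> wd M ?v \<in> factor F M"
      proof (cases "M \<in> insert L \<L>")
        case True
        then have "wd M ?v = wd M y" by (auto simp: wd_eq_iff[OF fin] override_on_def)
        then show ?thesis using sig[OF M] by simp
      next
        case False
        have "M \<inter> N = {}" if "N \<in> insert L \<L>" for N
          by (rule blocks_disjoint[OF M]) (use that False insert.prems in auto)
        then have "i \<notin> \<Union>(insert L \<L>)" if "i \<in> M" for i using that by blast
        then have "wd M ?v = wd M x"
          unfolding wd_eq_iff[OF fin] by (intro ballI override_on_apply_notin)
        then show ?thesis by simp
      qed
    qed
    then have v: "F ?v" using x by simp
    moreover have "reach S (wd K ?u) (wd K ?v)"
    proof (rule reach_block[OF blocks_subset[OF L] blocks_connected[OF L] _ v])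
      show "F ?u" using insert by simp
      show "i \<notin> L \<Longrightarrow> ?u i = ?v i" for i by (simp add: override_on_def)
    qed
    moreover have "reach S (wd K x) (wd K ?u)" using insert by simp
    ultimately show ?case using reach_trans by blast
  qed
  have "wd K (override_on x y (\<Union>(block F ` K))) = wd K y"
    unfolding Union_blocks by (simp add: wd_eq_iff finK override_on_def)
  moreover have "finite (block F ` K)" using finK by simp
  ultimately show ?thesis using step[of "block F ` K"] by simp
qed

text \<open>Each new condition halves the count: its factor is balanced in a direction of its own
  block, on which the earlier conditions do not depend.\<close>

lemma card_signature:
  assumes "finite \<L>" "\<L> \<subseteq> block F ` K"
  shows "2 ^ card \<L> * card {wd K x | x. \<forall>L\<in>\<L>. (wd L x \<in> factor F L) = s L} = card (words (card K))"
  using assms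
proof (induction \<L> rule: finite_induct)
  case empty
  have "{wd K x | x. True} = words (card K)" using words_wd[OF finK] by auto
  then show ?case by simp
next
  case (insert L \<L>)
  let ?P = "\<lambda>\<L> x. \<forall>L\<in>\<L>. (wd L x \<in> factor F L) = s L"
  have mem: "wd K x \<in> {wd K x | x. ?P \<M> x} \<longleftrightarrow> ?P \<M> x" if \<M>: "\<M> \<subseteq> block F ` K" for \<M> x
  proof -
    have wd: "wd M x = wd M y" if "M \<in> \<M>" "wd K x = wd K y" for M y
    proof -
      have M: "M \<in> block F ` K" using that \<M> by blast
      show ?thesis
        using blocks_subset[OF M] that(2) unfolding wd_eq_iff[OF finK] wd_eq_iff[OF blocks_finite[OF M]] by blast
    qed
    show ?thesis
    proof
      assume "wd K x \<in> {wd K x | x. ?P \<M> x}"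
      then obtain y where y: "wd K x = wd K y" "?P \<M> y" by blast
      show "?P \<M> x"
      proof
        fix M assume "M \<in> \<M>"
        then show "(wd M x \<in> factor F M) = s M" using wd[OF _ y(1)] y(2) by simp
      qed
    qed blast
  qed
  have L: "L \<in> block F ` K" and \<L>: "\<L> \<subseteq> block F ` K" using insert.prems by auto
  obtain i where i: "i \<in> L" using blocks_nonempty[OF L] by blast
  have "card {wd K x | x. ?P \<L> x} = 2 * card {wd K x | x. ?P (insert L \<L>) x}"
  proof (rule card_halve[OF finK])
    show "i \<in> K" using i blocks_subset[OF L] by blast
    fix x
    define q where "q = ?P \<L> x"
    have inv: "?P \<L> (x(i := a)) \<longleftrightarrow> q" for a
      unfolding q_def
    proof (rule ball_cong[OF refl])
      fix M assume "M \<in> \<L>"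
      then have M: "M \<in> block F ` K" "M \<noteq> L" using \<L> insert.hyps(2) by auto
      have "i \<notin> M" using blocks_disjoint[OF L M(1)] M(2) i by auto
      from wd_upd_out[OF blocks_finite[OF M(1)] this]
      show "((wd M (x(i := a)) \<in> factor F M) = s M) = ((wd M x \<in> factor F M) = s M)"
        by (simp only:)
    qed
    have "card {a. (wd L (x(i := a)) \<in> factor F L) = s L} = 2"
      using factor_mds[OF L] i unfolding double_MDS_wd[OF blocks_finite[OF L]]
      by (simp add: bal_eq_const flip: bal_def)
    moreover have "card (UNIV :: letter set) = 4" by (simp add: UNIV_letter)
    ultimately show "card {a. wd K (x(i := a)) \<in> {wd K x | x. ?P \<L> x}} =
        2 * card {a. wd K (x(i := a)) \<in> {wd K x | x. ?P (insert L \<L>) x}}"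
      unfolding mem[OF \<L>] mem[OF insert.prems] unfolding ball_simps inv
      by (cases q) simp_all
  qed auto
  then show ?case using insert by simp
qed

lemma card_half:
  assumes "K \<noteq> {}"
  shows "2 * card S = card (words (card K))"
proof -
  obtain i where i: "i \<in> K" using assms by blast
  have "card (UNIV :: letter set) = 4" by (simp add: UNIV_letter)
  then show ?thesis
    using card_halve[OF finK i S_words order_refl] bal[OF i] by (simp add: bal_def)
qed

lemma card_component:
  assumes "A \<in> components S"
  shows "2 ^ card (block F ` K) * card A = card (words (card K))"
proof -
  obtain w where w: "w \<in> S" "A = {y \<in> S. reach S w y}" using assms by (auto simp: components_def)
  obtain x where x: "w = wd K x" using words_wd[OF finK] w S_words by blast
  have "A = {wd K y | y. \<forall>L\<in>block F ` K. (wd L y \<in> factor F L) = (wd L x \<in> factor F L)}"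
  proof (intro equalityI subsetI)
    fix v assume v: "v \<in> A"
    then obtain y where y: "v = wd K y" using words_wd[OF finK] w S_words by blast
    then show "v \<in> {wd K y | y. \<forall>L\<in>block F ` K. (wd L y \<in> factor F L) = (wd L x \<in> factor F L)}"
      using reach_signature[of x y] v w(2) x by auto
  next
    fix v assume "v \<in> {wd K y | y. \<forall>L\<in>block F ` K. (wd L y \<in> factor F L) = (wd L x \<in> factor F L)}"
    then obtain y where y: "v = wd K y"
      "\<And>L. L \<in> block F ` K \<Longrightarrow> (wd L x \<in> factor F L) = (wd L y \<in> factor F L)" by blast
    then have "reach S w v" using signature_reach[of x y] w(1) x by simp
    then show "v \<in> A" using w reach_in by auto
  qed
  then show ?thesis using card_signature[of "block F ` K"] finK by simp
qed

lemma components_card_eq: "A \<in> components S \<Longrightarrow> B \<in> components S \<Longrightarrow> card A = card B"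
  using card_component[of A] card_component[of B] by (metis mult_cancel1 power_not_zero zero_neq_numeral)

text \<open>Each component takes the fraction \<open>1 / 2 ^ k\<close> of all words, with
  \<open>k\<close> the number of blocks, and \<open>S\<close> takes one half of them.\<close>

lemma card_components:
  assumes "K \<noteq> {}"
  shows "card (components S) = 2 ^ (card (block F ` K) - 1)"
proof -
  let ?k = "card (block F ` K)"
  have k: "?k = Suc (?k - 1)" using assms finK by (simp add: card_gt_0_iff)
  have pos: "card (words (card K)) > 0"
    unfolding card_gt_0_iff using wd_in_words[of K zero] finite_words by blast
  have fin: "finite (components S)" using finite_S by (simp add: components_def)
  have un: "\<Union> (components S) = S" and disj: "pairwise disjnt (components S)"
    using is_partition_components[of S] unfolding is_partition_def pairwise_def disjnt_def by auto
  have "finite A" if "A \<in> components S" for A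
    using that un finite_S by (metis Sup_upper finite_subset)
  from card_Union_disjoint[OF disj this] have "card S = sum card (components S)" unfolding un .
  then have "2 ^ ?k * card S = (\<Sum>A\<in>components S. 2 ^ ?k * card A)" by (simp add: sum_distrib_left)
  also have "\<dots> = card (components S) * card (words (card K))"
    using card_component by simp
  finally have "2 ^ ?k * card S = card (components S) * (2 * card S)" using card_half[OF assms] by simp
  moreover have "card S > 0" using pos card_half[OF assms] by simp
  ultimately have "2 ^ ?k = card (components S) * 2" by simp
  then show ?thesis using k power_Suc[of "2 :: nat" "?k - 1"] by simp
qed

end

section \<open>The representation\<close>

lemma double_MDS_compl:
  fixes K :: "nat set"
  assumes "finite K" "double_MDS (card K) S"
  shows "double_MDS (card K) (words (card K) - S)"
  using assms(2) unfolding double_MDS_wd[OF assms(1)] by (auto simp: bal_Not)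

text \<open>Complementing \<open>F\<close> preserves all comparisons between its values. Hence a
  code and its complement have the same number of components.\<close>

lemma block_compl: "block (\<lambda>x. wd K x \<in> words (card K) - S) = block (\<lambda>x. wd K x \<in> S)"
proof -
  have "(\<lambda>x. wd K x \<in> words (card K) - S) = (\<lambda>x. (wd K x \<in> S) = False)" by auto
  then have "indec (\<lambda>x. wd K x \<in> words (card K) - S) = indec (\<lambda>x. wd K x \<in> S)"
    by (simp only: indec_eq_const)
  then show ?thesis unfolding block_def by (simp only:)
qed

section \<open>Uniqueness: every representation is the one given by blocks and factors\<close>

locale mds_upt = mds "{0..<n}" S for n S

locale representation = mds_upt +
  fixes k :: nat and B :: "nat \<Rightarrow> nat set" and C :: "nat \<Rightarrow> nat list set" and \<sigma> :: nat
  assumes repr: "repr n S k B C \<sigma>"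
begin

lemma B_sub: "j < k \<Longrightarrow> B j \<subseteq> {0..<n}" and B_ne: "j < k \<Longrightarrow> B j \<noteq> {}"
  and B_disj: "j < k \<Longrightarrow> j' < k \<Longrightarrow> j \<noteq> j' \<Longrightarrow> B j \<inter> B j' = {}"
  and B_Union: "(\<Union>j<k. B j) = {0..<n}"
  and C_mds: "j < k \<Longrightarrow> double_MDS (card (B j)) (C j)"
  and C_prime: "j < k \<Longrightarrow> prime_code (card (B j)) (C j)"
  and C_zero: "j < k \<Longrightarrow> wd (B j) zero \<in> C j"
  and \<sigma>: "\<sigma> \<in> {0, 1}"
  using repr unfolding repr_def wd_zero by blast+

lemma B_fin: "j < k \<Longrightarrow> finite (B j)"
  using B_sub finite_subset by blast

definition total :: "(nat \<Rightarrow> letter) \<Rightarrow> nat" where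
  "total x = (\<Sum>j<k. of_bool (wd (B j) x \<in> C j))"

lemma F_iff: "F x \<longleftrightarrow> odd (total x + \<sigma>)"
proof -
  have "of_bool (F x) = ((\<Sum>j<k. of_bool (nths (wd {0..<n} x) (B j) \<in> C j)) + \<sigma>) mod 2"
    using repr wd_in_words[of "{0..<n}" x] unfolding repr_def by simp
  also have "(\<Sum>j<k. of_bool (nths (wd {0..<n} x) (B j) \<in> C j)) = total x"
    unfolding total_def by (intro sum.cong) (auto simp: nths_wd B_sub)
  finally show ?thesis by (cases "F x") (auto simp: odd_iff_mod_2_eq_one even_iff_mod_2_eq_zero)
qed

text \<open>On the slice through zero in the directions \<open>B j\<close>, all other codes keep
  their value at zero, so the parity depends on \<open>C j\<close> alone.\<close>

lemma C_iff:
  assumes j: "j < k"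
  shows "wd (B j) x \<in> C j \<longleftrightarrow> F (override_on zero x (B j)) = F zero"
proof -
  let ?y = "override_on zero x (B j)"
  define r where "r = (\<Sum>j'\<in>{..<k} - {j}. of_bool (wd (B j') zero \<in> C j') :: nat)"
  have other: "wd (B j') ?y = wd (B j') zero" if "j' \<in> {..<k} - {j}" for j'
  proof -
    have "i \<notin> B j" if "i \<in> B j'" for i using B_disj[of j j'] j \<open>j' \<in> _\<close> that by auto
    then show ?thesis
      using that by (auto simp: wd_eq_iff B_fin)
  qed
  have own: "wd (B j) ?y = wd (B j) x" by (simp add: wd_eq_iff B_fin[OF j])
  have "total ?y = of_bool (wd (B j) x \<in> C j) + r"
  proof -
    have "(\<Sum>j'\<in>{..<k} - {j}. of_bool (wd (B j') ?y \<in> C j')) = r"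
      unfolding r_def by (rule sum.cong) (simp_all only: other)
    then show ?thesis
      unfolding total_def using j by (subst sum.remove[of _ j]) (simp_all only: own lessThan_iff finite_lessThan)
  qed
  moreover have "total zero = 1 + r"
    unfolding total_def r_def using j C_zero[OF j]
    by (subst sum.remove[of _ j]) (simp_all only: lessThan_iff finite_lessThan of_bool_eq simp_thms)
  ultimately show ?thesis unfolding F_iff by auto
qed

lemma C_factor: "j < k \<Longrightarrow> C j = factor F (B j)"
proof -
  assume j: "j < k"
  have iff: "w \<in> C j \<longleftrightarrow> w \<in> factor F (B j)" if w: "w \<in> words (card (B j))" for w
  proof -
    obtain x where x: "w = wd (B j) x" using words_wd[OF B_fin[OF j] w] .
    show ?thesis unfolding x C_iff[OF j] wd_in_factor[OF B_fin[OF j]] ..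
  qed
  have "C j \<subseteq> words (card (B j))" using C_mds[OF j] by (simp add: double_MDS_def)
  then show ?thesis
    using factor_words[of F "B j"] iff by blast
qed

text \<open>All \<open>k\<close> codes contain the zero word, so evaluating at \<open>zero\<close>
  determines the constant.\<close>

lemma \<sigma>_eq: "\<sigma> = (k + of_bool (F zero)) mod 2"
proof -
  have "total zero = k" unfolding total_def using C_zero by simp
  then show ?thesis using F_iff[of zero] \<sigma> by (cases "F zero") (auto simp: mod2_eq_if)
qed

text \<open>No summand of \<open>total\<close> depends on both \<open>i\<close> and
  \<open>l\<close>, so its mixed difference vanishes already over the integers.\<close>

lemma not_indec:
  assumes "j < k" "j' < k" "j \<noteq> j'" "i \<in> B j" "l \<in> B j'"
  shows "\<not> indec F i l"
proof -
  have "(F x = F (x(i := a))) = (F (x(l := b)) = F (x(i := a, l := b)))" for x a b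
  proof -
    have "total x + total (x(i := a, l := b)) = total (x(i := a)) + total (x(l := b))"
      unfolding total_def sum.distrib[symmetric]
    proof (rule sum.cong[OF refl])
      fix m assume "m \<in> {..<k}"
      then have m: "finite (B m)" "i \<notin> B m \<or> l \<notin> B m"
        using B_fin B_disj[of m j] B_disj[of m j'] assms by auto
      show "of_bool (wd (B m) x \<in> C m) + of_bool (wd (B m) (x(i := a, l := b)) \<in> C m) =
          of_bool (wd (B m) (x(i := a)) \<in> C m) + (of_bool (wd (B m) (x(l := b)) \<in> C m) :: nat)"
        using m(2)
      proof
        assume i: "i \<notin> B m"
        have "wd (B m) (x(i := a)) = wd (B m) x" "wd (B m) (x(i := a, l := b)) = wd (B m) (x(l := b))"
          using i by (auto simp: wd_eq_iff m(1))
        then show ?thesis by simp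
      next
        assume l: "l \<notin> B m"
        then show ?thesis by (simp only: wd_upd_out[OF m(1) l] add.commute)
      qed
    qed
    then have "even (total x + total (x(i := a, l := b))) = even (total (x(i := a)) + total (x(l := b)))"
      by simp
    then show ?thesis unfolding F_iff even_add by argo
  qed
  then show ?thesis unfolding indec_def by blast
qed

text \<open>If \<open>B j\<close> split into unlinked parts \<open>U\<close> and \<open>V\<close>,
  then on \<open>C j\<close> the value of the \<open>U\<close>-part would be invariant along edges.
  The graph of the prime code \<open>C j\<close> is connected, yet both values occur.\<close>

lemma B_connected:
  assumes j: "j < k" and i: "i \<in> B j"
  shows "B j \<subseteq> block F i"
proof (rule ccontr)
  assume "\<not> B j \<subseteq> block F i"
  define U where "U = B j \<inter> block F i"
  define V where "V = B j - block F i"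
  obtain v where v: "v \<in> V" using \<open>\<not> B j \<subseteq> block F i\<close> unfolding V_def by blast
  have u: "i \<in> U" using i block_self unfolding U_def by blast
  have UV: "B j = U \<union> V" "U \<inter> V = {}" "finite V" using B_fin[OF j] by (auto simp: U_def V_def)
  have no: "\<not> indec F p q" if "p \<in> U" "q \<in> V" for p q
    using that unfolding U_def V_def block_def by (auto dest: rtranclp.rtrancl_into_rtrancl)
  interpret Cj: mds "B j" "C j" by unfold_locales (rule B_fin[OF j] C_mds[OF j])+
  \<comment> \<open>\<open>h\<close> records whether the \<open>U\<close>-part of the word, with
    zeros elsewhere, leaves \<open>F\<close> at its value in zero.\<close>
  define h where "h w \<longleftrightarrow> (\<exists>x. w = wd (B j) x \<and> F (override_on zero x U) = F zero)" for w
  have h_wd: "h (wd (B j) x) \<longleftrightarrow> F (override_on zero x U) = F zero" for x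
  proof -
    have "override_on zero x U = override_on zero y U" if "wd (B j) x = wd (B j) y" for y
      using that UV(1) unfolding wd_eq_iff[OF B_fin[OF j]] by (auto simp: fun_eq_iff override_on_def)
    then show ?thesis unfolding h_def by (smt (verit))
  qed
  have h_const: "h w" if "reach (C j) (wd (B j) zero) w" for w
  proof (rule reach_invariant[where h = h, OF that])
    have "override_on zero zero U = zero" by (simp add: fun_eq_iff override_on_def)
    then show "h (wd (B j) zero)" unfolding h_wd by simp
    fix w w' assume w: "w \<in> C j" "w' \<in> C j" "adj w w'" "h w"
    obtain x where x: "w = wd (B j) x" using words_wd[OF B_fin[OF j]] w(1) Cj.S_words by blast
    obtain y where y: "w' = wd (B j) y" using words_wd[OF B_fin[OF j]] w(2) Cj.S_words by blast
    obtain p where p: "p \<in> B j" "wd (B j) y = wd (B j) (x(p := y p))"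
      using w(3) unfolding x y adj_wd_iff[OF B_fin[OF j]] by blast
    define x' where "x' = x(p := y p)"
    have x': "w' = wd (B j) x'" unfolding y p(2) x'_def ..
    have "F (override_on zero x' U) = F zero"
    proof (cases "p \<in> U")
      case True
      let ?z = "override_on zero x (B j)"
      have "override_on zero x' (B j) = ?z(p := y p)" "override_on ?z zero V = override_on zero x U"
        "override_on (?z(p := y p)) zero V = override_on zero x' U"
        using True UV p(1) by (auto simp: fun_eq_iff override_on_def x'_def)
      moreover have "(F ?z = F (override_on ?z zero V)) =
          (F (?z(p := y p)) = F (override_on (?z(p := y p)) zero V))"
        using True UV no by (intro separate1) auto
      moreover have "F ?z = F zero" "F (override_on zero x' (B j)) = F zero"
        using w(1,2) C_iff[OF j] unfolding x x' by auto
      ultimately show ?thesis using w(4) unfolding x h_wd by metis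
    next
      case False
      then have "override_on zero x' U = override_on zero x U"
        by (auto simp: fun_eq_iff override_on_def x'_def)
      then show ?thesis using w(4) unfolding x h_wd by simp
    qed
    then show "h w'" unfolding x' h_wd .
  qed
  have iv: "i \<noteq> v" "i \<in> {0..<n}" "v \<in> {0..<n}" "i \<notin> V" "v \<notin> U" "i \<in> B j" "v \<in> B j"
    using u v UV B_sub[OF j] by auto
  \<comment> \<open>Changing coordinate \<open>i\<close> to \<open>a\<close> or \<open>v\<close> to
    \<open>b\<close> flips \<open>F\<close>. As \<open>i\<close> and \<open>v\<close> are unlinked,
    doing both restores it, giving a word of \<open>C j\<close> whose \<open>U\<close>-part is
    flipped.\<close>
  obtain a where a: "F (zero(i := a)) \<noteq> F zero" using bal_ex[OF bal[OF iv(2)], of zero "\<not> F zero"] by auto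
  obtain b where b: "F (zero(v := b)) \<noteq> F zero" using bal_ex[OF bal[OF iv(3)], of zero "\<not> F zero"] by auto
  let ?x = "zero(i := a, v := b)"
  have "F ?x = F zero" using no[OF u v] a b unfolding indec_def by blast
  moreover have "override_on zero ?x (B j) = ?x" "override_on zero ?x U = zero(i := a)"
    using iv u by (auto simp: fun_eq_iff override_on_def)
  ultimately have "wd (B j) ?x \<in> C j" "\<not> h (wd (B j) ?x)"
    unfolding C_iff[OF j] h_wd using a by auto
  then show False using h_const Cj.prime_connected[OF C_prime[OF j] C_zero[OF j]] by blast
qed

lemma B_block:
  assumes j: "j < k" and i: "i \<in> B j"
  shows "B j = block F i"
proof
  show "B j \<subseteq> block F i" using B_connected[OF assms] .
  show "block F i \<subseteq> B j"
  proof
    fix l assume "l \<in> block F i"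
    then have "(indec F)\<^sup>*\<^sup>* i l" by (simp add: block_def)
    then show "l \<in> B j"
    proof (induction rule: rtranclp_induct)
      case (step p q)
      have "q \<in> {0..<n}" using indec_in step by blast
      then obtain j' where "j' < k" "q \<in> B j'" using B_Union by blast
      then show ?case using not_indec[OF j, of j' p q] step by (cases "j = j'") auto
    qed (rule i)
  qed
qed

lemma B_blocks: "B ` {..<k} = block F ` {0..<n}"
proof (intro equalityI subsetI)
  fix L assume "L \<in> B ` {..<k}"
  then obtain j where j: "j < k" "L = B j" by blast
  then obtain i where "i \<in> B j" using B_ne by blast
  then show "L \<in> block F ` {0..<n}" using B_block[OF j(1)] j B_sub[OF j(1)] by blast
next
  fix L assume "L \<in> block F ` {0..<n}"
  then obtain i where i: "i \<in> {0..<n}" "L = block F i" by blast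
  then obtain j where j: "j < k" "i \<in> B j" using B_Union by blast
  then show "L \<in> B ` {..<k}" using B_block[OF j] i by auto
qed

lemma k_eq: "k = card (block F ` {0..<n})"
proof -
  have "inj_on B {..<k}" using B_disj B_ne unfolding inj_on_def by blast
  then show ?thesis unfolding B_blocks[symmetric] by (simp add: card_image)
qed

lemma pairs_eq: "{(B j, C j) | j. j < k} = (\<lambda>L. (L, factor F L)) ` block F ` {0..<n}"
  unfolding B_blocks[symmetric] using C_factor by (auto simp: image_iff)

end

section \<open>Existence of the representation, and bipartite factors\<close>

context mds_upt
begin

lemma repr_blocks:
  assumes n: "n \<ge> 1" and B: "bij_betw B {..<k} (block F ` {0..<n})"
  shows "repr n S k B (\<lambda>j. factor F (B j)) ((k + of_bool (F zero)) mod 2)"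
proof -
  have k: "k = card (block F ` {0..<n})" using bij_betw_same_card[OF B] by simp
  have Bj: "B j \<in> block F ` {0..<n}" if "j < k" for j using B that by (auto simp: bij_betw_def)
  have "1 \<le> k" unfolding k using n by (simp add: Suc_le_eq card_gt_0_iff)
  moreover have "k \<le> n" unfolding k using card_image_le[of "{0..<n}" "block F"] by simp
  moreover have "B j \<inter> B j' = {}" if "j < k" "j' < k" "j \<noteq> j'" for j j'
    using inj_onD[OF bij_betw_imp_inj_on[OF B], of j j'] that
    by (intro blocks_disjoint[OF Bj Bj]) auto
  moreover have "(\<Union>j<k. B j) = {0..<n}" using Union_blocks B by (simp add: bij_betw_def)
  moreover have "of_bool (w \<in> S) =
      ((\<Sum>j<k. of_bool (nths w (B j) \<in> factor F (B j))) + (k + of_bool (F zero)) mod 2) mod 2"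
    if w: "w \<in> words n" for w
  proof -
    obtain x where x: "w = wd {0..<n} x" using words_wd[of "{0..<n}" w] w by auto
    let ?in = "{L \<in> block F ` {0..<n}. wd L x \<in> factor F L}"
    let ?out = "{L \<in> block F ` {0..<n}. wd L x \<notin> factor F L}"
    have "(\<Sum>j<k. of_bool (nths w (B j) \<in> factor F (B j))) =
        (\<Sum>j<k. of_bool (wd (B j) x \<in> factor F (B j)) :: nat)"
      unfolding x using blocks_subset[OF Bj] by (intro sum.cong) (auto simp: nths_wd)
    also have "\<dots> = (\<Sum>L\<in>block F ` {0..<n}. of_bool (wd L x \<in> factor F L))"
      by (rule sum.reindex_bij_betw[OF B])
    also have "\<dots> = card ?in" by (simp add: of_bool_def sum.If_cases Int_def)
    finally have sum: "(\<Sum>j<k. of_bool (nths w (B j) \<in> factor F (B j))) = card ?in" .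
    \<comment> \<open>The representation counts factors that contain the word, whereas
      \<open>parity\<close> counts those that do not; the difference is absorbed by \<open>k\<close>
      in the constant.\<close>
    have "block F ` {0..<n} = ?in \<union> ?out" by blast
    then have "k = card ?in + card ?out" unfolding k
      by (metis (no_types, lifting) card_Un_disjoint disjoint_iff finite_Un finite_atLeastLessThan finite_imageI mem_Collect_eq)
    then have "even (k + card ?in) \<longleftrightarrow> even (card ?out)" by (simp only: even_add) blast
    then have par: "(F x = F zero) \<longleftrightarrow> even (k + card ?in)" using parity[of x] by (simp only:)
    have "of_bool (w \<in> S) = (card ?in + (k + of_bool (F zero))) mod 2"
      using par unfolding x by (cases "F x"; cases "F zero") (auto simp: mod2_eq_if)
    then show ?thesis unfolding sum by (simp add: mod_add_right_eq)
  qed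
  moreover have "(k + of_bool (F zero)) mod 2 \<in> {0, 1}" by (auto simp: mod2_eq_if)
  ultimately show ?thesis
    unfolding repr_def using blocks_nonempty[OF Bj] factor_mds[OF Bj] factor_prime[OF Bj] zero_in_factor by simp
qed

text \<open>Slices of \<open>S\<close> in the directions \<open>L\<close> are the factor or its
  complement. A letter in the second block \<open>L'\<close> switches between the two, so both embed
  into \<open>S\<close>.\<close>

lemma bipartite_factors:
  assumes "bipartite S" and L: "L \<in> block F ` {0..<n}" "L' \<in> block F ` {0..<n}" "L \<noteq> L'"
  shows "bipartite (factor F L)" "bipartite (words (card L) - factor F L)"
proof -
  obtain i where i: "i \<in> L'" using blocks_nonempty[OF L(2)] by blast
  have in_n: "i \<in> {0..<n}" using i blocks_subset[OF L(2)] by blast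
  have iL: "i \<notin> L" using blocks_disjoint[OF L(1,2)] L(3) i by blast
  obtain a where a: "F (zero(i := a)) \<noteq> F zero"
    using bal_ex[OF bal[OF in_n], of zero "\<not> F zero"] by auto
  have flip: "F (override_on (zero(i := a)) x L) \<noteq> F (override_on zero x L)" for x
  proof -
    have "\<not> indec F i v" if "v \<in> L" for v
      using blocks_closed[OF L(2) i] blocks_disjoint[OF L(1,2)] L(3) that by blast
    from separate1[OF blocks_finite[OF L(1)] iL this, of zero x a] show ?thesis using a by blast
  qed
  have "\<exists>z. \<forall>x. F (override_on z x L) \<longleftrightarrow> (wd L x \<in> factor F L) = t" for t
  proof (cases "F zero = t")
    case True
    then show ?thesis unfolding wd_in_factor[OF blocks_finite[OF L(1)]] by (intro exI[of _ zero]) auto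
  next
    case False
    then show ?thesis
      unfolding wd_in_factor[OF blocks_finite[OF L(1)]] using flip by (intro exI[of _ "zero(i := a)"]) blast
  qed
  \<comment> \<open>\<open>z True\<close> freezes a slice equal to the factor,
    \<open>z False\<close> one equal to its complement.\<close>
  then obtain z where z: "\<And>t x. F (override_on (z t) x L) \<longleftrightarrow> (wd L x \<in> factor F L) = t" by metis
  note embed = bipartite_embed[OF finK blocks_subset[OF L(1)] assms(1)]
  show "bipartite (factor F L)"
    by (rule embed[OF factor_words, of F "z True"]) (simp add: z)
  show "bipartite (words (card L) - factor F L)"
    by (rule embed[of _ "z False"]) (auto simp: z)
qed

end

theorem theorem1:
  fixes n :: nat and S :: "nat list set"
  assumes "n \<ge> 1" and "double_MDS n S"
  shows "\<exists>k K C \<sigma>0.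
    repr n S k K C \<sigma>0 \<and>
    (\<forall>k' K' C' \<sigma>0'. repr n S k' K' C' \<sigma>0' \<longrightarrow>
        k' = k \<and> \<sigma>0' = \<sigma>0 \<and>
        {(K' j, C' j) | j. j < k'} = {(K j, C j) | j. j < k}) \<and>
    (\<exists>P. is_partition P S \<and> card P = 2 ^ (k - 1) \<and>
        (\<forall>A\<in>P. prime_code n A) \<and> (\<forall>A\<in>P. \<forall>B\<in>P. card A = card B)) \<and>
    (\<exists>P. is_partition P (words n - S) \<and> card P = 2 ^ (k - 1) \<and>
        (\<forall>A\<in>P. prime_code n A) \<and> (\<forall>A\<in>P. \<forall>B\<in>P. card A = card B)) \<and>
    card (components S) = 2 ^ (k - 1) \<and>
    (\<forall>A\<in>components S. \<forall>B\<in>components S. card A = card B) \<and>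
    card (components (words n - S)) = 2 ^ (k - 1) \<and>
    (\<forall>A\<in>components (words n - S). \<forall>B\<in>components (words n - S). card A = card B) \<and>
    (k \<ge> 2 \<and> bipartite S \<longrightarrow>
       (\<forall>j<k. bipartite (C j) \<and> bipartite (words (card (K j)) - C j)))"
proof -
  have card_n: "card {0..<n} = n" and ne: "{0..<n} \<noteq> {}" using assms(1) by auto
  interpret M: mds_upt n S using assms(2) by unfold_locales simp_all
  have "double_MDS n (words n - S)" using double_MDS_compl[of "{0..<n}" S] assms(2) by simp
  then interpret M': mds "{0..<n}" "words n - S" by unfold_locales simp_all
  have blocks': "block M'.F = block M.F" using block_compl[of "{0..<n}" S] by simp
  define k where "k = card (block M.F ` {0..<n})"
  obtain K where K: "bij_betw K {..<k} (block M.F ` {0..<n})"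
    unfolding k_def using ex_bij_betw_nat_finite[of "block M.F ` {0..<n}"] by (auto simp: atLeast0LessThan)
  define C where "C j = factor M.F (K j)" for j
  define \<sigma>0 :: nat where "\<sigma>0 = (k + of_bool (M.F zero)) mod 2"
  have repr: "repr n S k K C \<sigma>0"
    unfolding C_def \<sigma>0_def using M.repr_blocks[OF assms(1) K] .
  have comps: "card (components S) = 2 ^ (k - 1)" "card (components (words n - S)) = 2 ^ (k - 1)"
    using M.card_components[OF ne] M'.card_components[OF ne] unfolding blocks' k_def by simp_all
  have primes: "\<forall>A\<in>components S. prime_code n A" "\<forall>A\<in>components (words n - S). prime_code n A"
    using M.prime_component M'.prime_component by simp_all
  have eqs: "\<forall>A\<in>components S. \<forall>B\<in>components S. card A = card B"
    "\<forall>A\<in>components (words n - S). \<forall>B\<in>components (words n - S). card A = card B"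
    using M.components_card_eq M'.components_card_eq by blast+
  have unique: "k' = k \<and> \<sigma>0' = \<sigma>0 \<and> {(K' j, C' j) | j. j < k'} = {(K j, C j) | j. j < k}"
    if "repr n S k' K' C' \<sigma>0'" for k' K' C' \<sigma>0'
  proof -
    interpret R: representation n S k' K' C' \<sigma>0' using that by unfold_locales
    interpret R0: representation n S k K C \<sigma>0 using repr by unfold_locales
    show ?thesis
      using R.k_eq R.\<sigma>_eq R.pairs_eq R0.k_eq R0.\<sigma>_eq R0.pairs_eq by simp
  qed
  have bip: "bipartite (C j) \<and> bipartite (words (card (K j)) - C j)"
    if "k \<ge> 2" "bipartite S" "j < k" for j
  proof -
    \<comment> \<open>Any second index will do; \<open>k \<ge> 2\<close> provides one.\<close>
    define j' :: nat where "j' = (if j = 0 then 1 else 0)"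
    have j': "j' < k" "j \<noteq> j'" using that by (auto simp: j'_def)
    have "K j \<in> block M.F ` {0..<n}" "K j' \<in> block M.F ` {0..<n}"
      using bij_betwE[OF K] that(3) j'(1) by blast+
    moreover have "K j \<noteq> K j'"
      using inj_onD[OF bij_betw_imp_inj_on[OF K]] that(3) j' by blast
    ultimately have "K j \<in> block M.F ` {0..<n}" "K j' \<in> block M.F ` {0..<n}" "K j \<noteq> K j'" .
    from M.bipartite_factors[OF that(2) this] show ?thesis unfolding C_def by blast
  qed
  have P1: "\<exists>P. is_partition P S \<and> card P = 2 ^ (k - 1) \<and>
        (\<forall>A\<in>P. prime_code n A) \<and> (\<forall>A\<in>P. \<forall>B\<in>P. card A = card B)"
    using is_partition_components comps(1) primes(1) eqs(1) by blast
  have P2: "\<exists>P. is_partition P (words n - S) \<and> card P = 2 ^ (k - 1) \<and>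
        (\<forall>A\<in>P. prime_code n A) \<and> (\<forall>A\<in>P. \<forall>B\<in>P. card A = card B)"
    using is_partition_components comps(2) primes(2) eqs(2) by blast
  show ?thesis
  proof (rule exI[of _ k], rule exI[of _ K], rule exI[of _ C], rule exI[of _ \<sigma>0], intro conjI)
    show "\<forall>k' K' C' \<sigma>0'. repr n S k' K' C' \<sigma>0' \<longrightarrow> k' = k \<and> \<sigma>0' = \<sigma>0 \<and>
        {(K' j, C' j) | j. j < k'} = {(K j, C j) | j. j < k}"
      by (intro allI impI unique)
    show "k \<ge> 2 \<and> bipartite S \<longrightarrow>
        (\<forall>j<k. bipartite (C j) \<and> bipartite (words (card (K j)) - C j))"
      by (intro impI allI bip) auto
  qed (rule repr P1 P2 comps eqs)+
qed

end
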